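(* Let $k_{||},k_\perp\in(0,1)$ be constants with $k_{||}^2+k_\perp^2=1$, and let $M^6$ be a $6$-dimensional compact manifold endowed with an $SU(2)$ structure $(J,g,\alpha,\omega,\Omega)$ such that the associated $2$-forms $Re(\Omega)_{||}$, $Re(\Omega)_\perp$, $Im(\Omega)$ (together with $\alpha$) satisfy the SUSY equations IIB. Then $M^6$ has first Betti number $\geq2$. In particular, there is no solution of the SUSY equations IIB on compact simply connected $6$-dimensional manifolds.
   Context: An $SU(2)$ structure $(J,g,\alpha,\omega,\Omega)$ on a $6$-manifold $M^6$ consists of an almost Hermitian structure $(J,g)$, a $(1,0)$-form $\alpha$ with $\|\alpha\|^2=i_{\overline\alpha}\alpha=2$, a real $2$-form $\omega$ and a $(2,0)$-form $\Omega$ with $\omega^2=\frac12\Omega\wedge\overline\Omega\neq0$, $\omega\wedge\Omega=0$, $\Omega\wedge\Omega=0$, $i_\alpha\Omega=0$, $i_\alpha\omega=0$, where $i_\alpha$ denotes contraction by the vector field dual to $\alpha$; the fundamental $2$-form $F(X,Y)=g(JX,Y)$ of $(J,g)$ is $F=\omega+\frac i2\alpha\wedge\overline\alpha$. Type IIB projection forms: given an $SU(2)$ structure and the constants $k_{||},k_\perp$, let $\phi\in(0,\frac\pi2)$ be defined by $k_{||}=\cos\phi$, $k_\perp=\sin\phi$, and put $$Re(\Omega)_{||}=\tfrac12\big((1-\cos2\phi)Re(\Omega)+\sin(2\phi)\,\omega\big),\quad Re(\Omega)_\perp=\tfrac12\big((1+\cos2\phi)Re(\Omega)-\sin(2\phi)\,\omega\big).$$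 SUSY equations IIB: the forms $(\alpha,Re(\Omega)_{||},Re(\Omega)_\perp,Im(\Omega))$ arising in this way from an $SU(2)$ structure are a solution if, for the $3$-form $H$ determined by the third equation, $$d(Re(\alpha))=0,\qquad d(Im(\alpha))=0,\qquad k_{||}H=k_\perp d(Im(\Omega)),$$ $$Re(\alpha)\wedge H=-\frac{k_\perp}{k_{||}}Im(\alpha)\wedge d(Re(\Omega)_\perp),\qquad Im(\alpha)\wedge H=\frac{k_\perp}{k_{||}}Re(\alpha)\wedge d(Re(\Omega)_\perp),$$ $$Re(\alpha)\wedge Im(\alpha)\wedge d(Re(\Omega)_{||})=-H\wedge Im(\Omega).$$ *)

theory Defs
  imports "HOL-Analysis.Analysis" "HOL-Homology.Homology" "HOL-Library.Extended_Nat"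
begin

definition int_independent :: "('g, 'm) monoid_scheme \<Rightarrow> 'g set \<Rightarrow> bool" where
  "int_independent G S \<longleftrightarrow> finite S \<and> S \<subseteq> carrier G \<and>
     (\<forall>n :: 'g \<Rightarrow> int. finprod G (\<lambda>s. s [^]\<^bsub>G\<^esub> n s) S = \<one>\<^bsub>G\<^esub> \<longrightarrow> (\<forall>s\<in>S. n s = 0))"

definition abelian_rank :: "('g, 'm) monoid_scheme \<Rightarrow> enat" where
  "abelian_rank G = Sup {enat (card S) |S. int_independent G S}"

definition betti_number :: "nat \<Rightarrow> 'a topology \<Rightarrow> enat" where
  "betti_number p X = abelian_rank (homology_group (int p) X)"

text \<open>\<open>C_k_on k S f\<close> is meant for open \<open>S\<close>.\<close>

primrec C_k_on :: "nat \<Rightarrow> 'e::euclidean_space set \<Rightarrow> ('e \<Rightarrow> 'f::real_normed_vector) \<Rightarrow> bool" where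
  "C_k_on 0 S f \<longleftrightarrow> continuous_on S f"
| "C_k_on (Suc k) S f \<longleftrightarrow> (\<forall>x\<in>S. f differentiable (at x)) \<and>
     (\<forall>v. C_k_on k S (\<lambda>x. frechet_derivative f (at x) v))"

definition smooth_on :: "'e::euclidean_space set \<Rightarrow> ('e \<Rightarrow> 'f::real_normed_vector) \<Rightarrow> bool" where
  "smooth_on S f \<longleftrightarrow> (\<forall>k. C_k_on k S f)"

text \<open>A chart is a pair of a coordinate domain \<open>U\<close> and a coordinate map, of which only the
  values on \<open>U\<close> matter.\<close>

type_synonym ('a, 'e) chart = "'a set \<times> ('a \<Rightarrow> 'e)"

definition chart_image :: "('a, 'e) chart \<Rightarrow> 'e set" where
  "chart_image c = snd c ` fst c"

definition overlap :: "('a, 'e) chart \<Rightarrow> ('a, 'e) chart \<Rightarrow> 'e set" where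
  "overlap c c' = snd c ` (fst c \<inter> fst c')"

definition transition :: "('a, 'e) chart \<Rightarrow> ('a, 'e) chart \<Rightarrow> 'e \<Rightarrow> 'e" where
  "transition c c' = snd c' \<circ> inv_into (fst c) (snd c)"

abbreviation transition_deriv ::
    "('a, 'e::euclidean_space) chart \<Rightarrow> ('a, 'e) chart \<Rightarrow> 'e \<Rightarrow> 'e \<Rightarrow> 'e" where
  "transition_deriv c c' x \<equiv> frechet_derivative (transition c c') (at x)"

text \<open>A nonempty smooth manifold without boundary, of dimension \<open>DIM('e)\<close>, not required to be
  connected. Its atlas \<open>A\<close> need not be maximal. The Hausdorff property and second countability
  are inherited from the ambient type.\<close>

definition smooth_manifold ::
    "'a::{t2_space, second_countable_topology} set \<Rightarrow> ('a, 'e::euclidean_space) chart set \<Rightarrow> bool" where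
  "smooth_manifold M A \<longleftrightarrow> M \<noteq> {} \<and> (\<Union>c\<in>A. fst c) = M \<and>
     (\<forall>c\<in>A. openin (top_of_set M) (fst c) \<and> open (chart_image c) \<and>
        (\<exists>h. homeomorphism (fst c) (chart_image c) (snd c) h)) \<and>
     (\<forall>c\<in>A. \<forall>c'\<in>A. smooth_on (overlap c c') (transition c c'))"

text \<open>A \<open>k\<close>-form is a function of a sequence of vectors of which only the entries with index
  below \<open>k\<close> matter. All forms are complex valued (but real multilinear).\<close>

type_synonym 'e form = "(nat \<Rightarrow> 'e) \<Rightarrow> complex"

definition alternating_form :: "nat \<Rightarrow> 'e::real_vector form \<Rightarrow> bool" where
  "alternating_form k a \<longleftrightarrow>
     (\<forall>v w. (\<forall>i<k. v i = w i) \<longrightarrow> a v = a w) \<and>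
     (\<forall>v. \<forall>i<k. linear (\<lambda>u. a (v(i := u)))) \<and>
     (\<forall>v. \<forall>i<k. \<forall>j<k. i \<noteq> j \<and> v i = v j \<longrightarrow> a v = 0)"

text \<open>The normalization is the one with \<open>(a \<and> b)(X, Y) = a(X) b(Y) - a(Y) b(X)\<close> for 1-forms. It
  is forced by \<open>F = \<omega> + (i/2) \<alpha> \<and> cnj \<alpha>\<close> together with \<open>F(X, Y) = g(JX, Y)\<close> and
  \<open>i\<^bsub>cnj \<alpha>\<^esub> \<alpha> = 2\<close>.\<close>

definition wedge :: "nat \<Rightarrow> nat \<Rightarrow> 'e form \<Rightarrow> 'e form \<Rightarrow> 'e form" where
  "wedge k l a b = (\<lambda>v. (\<Sum>\<sigma> | \<sigma> permutes {..<k + l}.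
       of_int (sign \<sigma>) * a (\<lambda>i. v (\<sigma> i)) * b (\<lambda>i. v (\<sigma> (k + i)))) / (fact k * fact l))"

definition cnj_form :: "'e form \<Rightarrow> 'e form" where
  "cnj_form a = (\<lambda>v. cnj (a v))"

definition Re_form :: "'e form \<Rightarrow> 'e form" where
  "Re_form a = (\<lambda>v. of_real (Re (a v)))"

definition Im_form :: "'e form \<Rightarrow> 'e form" where
  "Im_form a = (\<lambda>v. of_real (Im (a v)))"

definition real_form :: "'e form \<Rightarrow> bool" where
  "real_form a \<longleftrightarrow> (\<forall>v. a v \<in> \<real>)"

text \<open>Type \<open>(k, 0)\<close> with respect to \<open>J\<close>: complex linearity in each argument.\<close>

definition type_k0 :: "nat \<Rightarrow> ('e \<Rightarrow> 'e) \<Rightarrow> 'e form \<Rightarrow> bool" where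
  "type_k0 k J a \<longleftrightarrow> (\<forall>v. \<forall>i<k. a (v(i := J (v i))) = \<i> * a v)"

definition metric_dual :: "('e \<Rightarrow> 'e \<Rightarrow> real) \<Rightarrow> ('e \<Rightarrow> real) \<Rightarrow> 'e" where
  "metric_dual g \<theta> = (THE u. \<forall>w. g u w = \<theta> w)"

text \<open>The contraction of \<open>b\<close> by the complex vector dual to the complex 1-form \<open>a\<close>, with respect to
  the complex bilinear (not sesquilinear) extension of \<open>g\<close>. With this reading the squared norm
  of \<open>a\<close> is the contraction of \<open>a\<close> itself by the dual of its conjugate.\<close>

definition contract :: "('e \<Rightarrow> 'e \<Rightarrow> real) \<Rightarrow> 'e form \<Rightarrow> 'e form \<Rightarrow> 'e form" where
  "contract g a b = (\<lambda>v.
     b (case_nat (metric_dual g (\<lambda>w. Re (a (\<lambda>_. w)))) v) +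
     \<i> * b (case_nat (metric_dual g (\<lambda>w. Im (a (\<lambda>_. w)))) v))"

definition fundamental_form :: "('e \<Rightarrow> 'e) \<Rightarrow> ('e \<Rightarrow> 'e \<Rightarrow> real) \<Rightarrow> 'e form" where
  "fundamental_form J g = (\<lambda>v. of_real (g (J (v 0)) (v 1)))"

text \<open>A tensor field is a family of local representatives, one for each chart, which are functions
  on the image of the chart and transform correctly under changes of charts.\<close>

type_synonym ('a, 'e) form_field = "('a, 'e) chart \<Rightarrow> 'e \<Rightarrow> 'e form"
type_synonym ('a, 'e) endo_field = "('a, 'e) chart \<Rightarrow> 'e \<Rightarrow> 'e \<Rightarrow> 'e"
type_synonym ('a, 'e) metric_field = "('a, 'e) chart \<Rightarrow> 'e \<Rightarrow> 'e \<Rightarrow> 'e \<Rightarrow> real"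

definition differential_form ::
    "('a, 'e::euclidean_space) chart set \<Rightarrow> nat \<Rightarrow> ('a, 'e) form_field \<Rightarrow> bool" where
  "differential_form A k w \<longleftrightarrow>
     (\<forall>c\<in>A. (\<forall>x\<in>chart_image c. alternating_form k (w c x)) \<and>
            (\<forall>v. smooth_on (chart_image c) (\<lambda>x. w c x v))) \<and>
     (\<forall>c\<in>A. \<forall>c'\<in>A. \<forall>x\<in>overlap c c'. \<forall>v.
        w c x v = w c' (transition c c' x) (\<lambda>i. transition_deriv c c' x (v i)))"

definition ext_deriv :: "nat \<Rightarrow> ('e::euclidean_space \<Rightarrow> 'e form) \<Rightarrow> 'e \<Rightarrow> 'e form" where
  "ext_deriv k w x = (\<lambda>v. \<Sum>i\<le>k. (- 1) ^ i *
     frechet_derivative (\<lambda>y. w y (\<lambda>j. if j < i then v j else v (Suc j))) (at x) (v i))"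

definition riemannian_metric ::
    "('a, 'e::euclidean_space) chart set \<Rightarrow> ('a, 'e) metric_field \<Rightarrow> bool" where
  "riemannian_metric A g \<longleftrightarrow>
     (\<forall>c\<in>A. (\<forall>x\<in>chart_image c. bilinear (g c x) \<and> (\<forall>u w. g c x u w = g c x w u) \<and>
                (\<forall>u. u \<noteq> 0 \<longrightarrow> 0 < g c x u u)) \<and>
            (\<forall>u w. smooth_on (chart_image c) (\<lambda>x. g c x u w))) \<and>
     (\<forall>c\<in>A. \<forall>c'\<in>A. \<forall>x\<in>overlap c c'. \<forall>u w.
        g c x u w = g c' (transition c c' x) (transition_deriv c c' x u) (transition_deriv c c' x w))"

definition almost_complex_structure ::
    "('a, 'e::euclidean_space) chart set \<Rightarrow> ('a, 'e) endo_field \<Rightarrow> bool" where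
  "almost_complex_structure A J \<longleftrightarrow>
     (\<forall>c\<in>A. (\<forall>x\<in>chart_image c. linear (J c x) \<and> (\<forall>u. J c x (J c x u) = - u)) \<and>
            (\<forall>u. smooth_on (chart_image c) (\<lambda>x. J c x u))) \<and>
     (\<forall>c\<in>A. \<forall>c'\<in>A. \<forall>x\<in>overlap c c'. \<forall>u.
        transition_deriv c c' x (J c x u) = J c' (transition c c' x) (transition_deriv c c' x u))"

definition almost_hermitian ::
    "('a, 'e::euclidean_space) chart set \<Rightarrow> ('a, 'e) endo_field \<Rightarrow> ('a, 'e) metric_field \<Rightarrow> bool" where
  "almost_hermitian A J g \<longleftrightarrow> almost_complex_structure A J \<and> riemannian_metric A g \<and>
     (\<forall>c\<in>A. \<forall>x\<in>chart_image c. \<forall>u w. g c x (J c x u) (J c x w) = g c x u w)"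

text \<open>The algebraic conditions at a point. The condition \<open>\<omega>\<^sup>2 \<noteq> 0\<close> is thus required at every
  point, that is, \<open>\<omega>\<^sup>2\<close> vanishes nowhere.\<close>

definition SU2_at ::
    "('e \<Rightarrow> 'e) \<Rightarrow> ('e \<Rightarrow> 'e \<Rightarrow> real) \<Rightarrow> 'e form \<Rightarrow> 'e form \<Rightarrow> 'e form \<Rightarrow> bool" where
  "SU2_at J g \<alpha> \<omega> \<Omega> \<longleftrightarrow>
     type_k0 1 J \<alpha> \<and> contract g (cnj_form \<alpha>) \<alpha> = (\<lambda>_. 2) \<and>
     real_form \<omega> \<and> type_k0 2 J \<Omega> \<and>
     wedge 2 2 \<omega> \<omega> = (\<lambda>v. 1 / 2 * wedge 2 2 \<Omega> (cnj_form \<Omega>) v) \<and>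
     wedge 2 2 \<omega> \<omega> \<noteq> (\<lambda>_. 0) \<and>
     wedge 2 2 \<omega> \<Omega> = (\<lambda>_. 0) \<and>
     wedge 2 2 \<Omega> \<Omega> = (\<lambda>_. 0) \<and>
     contract g \<alpha> \<Omega> = (\<lambda>_. 0) \<and>
     contract g \<alpha> \<omega> = (\<lambda>_. 0) \<and>
     fundamental_form J g = (\<lambda>v. \<omega> v + \<i> / 2 * wedge 1 1 \<alpha> (cnj_form \<alpha>) v)"

definition SU2_structure ::
    "('a, 'e::euclidean_space) chart set \<Rightarrow> ('a, 'e) endo_field \<Rightarrow> ('a, 'e) metric_field \<Rightarrow>
     ('a, 'e) form_field \<Rightarrow> ('a, 'e) form_field \<Rightarrow> ('a, 'e) form_field \<Rightarrow> bool" where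
  "SU2_structure A J g \<alpha> \<omega> \<Omega> \<longleftrightarrow> almost_hermitian A J g \<and>
     differential_form A 1 \<alpha> \<and> differential_form A 2 \<omega> \<and> differential_form A 2 \<Omega> \<and>
     (\<forall>c\<in>A. \<forall>x\<in>chart_image c. SU2_at (J c x) (g c x) (\<alpha> c x) (\<omega> c x) (\<Omega> c x))"

definition Re_par :: "real \<Rightarrow> 'e form \<Rightarrow> 'e form \<Rightarrow> 'e form" where
  "Re_par \<phi> \<omega> \<Omega> = (\<lambda>v. 1 / 2 *
     (of_real (1 - cos (2 * \<phi>)) * Re_form \<Omega> v + of_real (sin (2 * \<phi>)) * \<omega> v))"

definition Re_perp :: "real \<Rightarrow> 'e form \<Rightarrow> 'e form \<Rightarrow> 'e form" where
  "Re_perp \<phi> \<omega> \<Omega> = (\<lambda>v. 1 / 2 *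
     (of_real (1 + cos (2 * \<phi>)) * Re_form \<Omega> v - of_real (sin (2 * \<phi>)) * \<omega> v))"

definition SUSY_IIB_at ::
    "real \<Rightarrow> real \<Rightarrow> real \<Rightarrow> ('e::euclidean_space \<Rightarrow> 'e form) \<Rightarrow> ('e \<Rightarrow> 'e form) \<Rightarrow> ('e \<Rightarrow> 'e form) \<Rightarrow>
     ('e \<Rightarrow> 'e form) \<Rightarrow> 'e \<Rightarrow> bool" where
  "SUSY_IIB_at kpar kperp \<phi> \<alpha> \<omega> \<Omega> H x \<longleftrightarrow>
     (let a1 = (\<lambda>y. Re_form (\<alpha> y)); a2 = (\<lambda>y. Im_form (\<alpha> y));
          Rpar = (\<lambda>y. Re_par \<phi> (\<omega> y) (\<Omega> y)); Rperp = (\<lambda>y. Re_perp \<phi> (\<omega> y) (\<Omega> y));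
          I = (\<lambda>y. Im_form (\<Omega> y))
      in ext_deriv 1 a1 x = (\<lambda>_. 0) \<and>
         ext_deriv 1 a2 x = (\<lambda>_. 0) \<and>
         (\<lambda>v. of_real kpar * H x v) = (\<lambda>v. of_real kperp * ext_deriv 2 I x v) \<and>
         wedge 1 3 (a1 x) (H x) =
           (\<lambda>v. - of_real (kperp / kpar) * wedge 1 3 (a2 x) (ext_deriv 2 Rperp x) v) \<and>
         wedge 1 3 (a2 x) (H x) =
           (\<lambda>v. of_real (kperp / kpar) * wedge 1 3 (a1 x) (ext_deriv 2 Rperp x) v) \<and>
         wedge 1 4 (a1 x) (wedge 1 3 (a2 x) (ext_deriv 2 Rpar x)) =
           (\<lambda>v. - wedge 3 2 (H x) (I x) v))"

definition SUSY_IIB ::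
    "('a, 'e::euclidean_space) chart set \<Rightarrow> real \<Rightarrow> real \<Rightarrow>
     ('a, 'e) form_field \<Rightarrow> ('a, 'e) form_field \<Rightarrow> ('a, 'e) form_field \<Rightarrow> bool" where
  "SUSY_IIB A kpar kperp \<alpha> \<omega> \<Omega> \<longleftrightarrow>
     (\<exists>\<phi> H. 0 < \<phi> \<and> \<phi> < pi / 2 \<and> kpar = cos \<phi> \<and> kperp = sin \<phi> \<and>
        differential_form A 3 H \<and>
        (\<forall>c\<in>A. \<forall>x\<in>chart_image c. SUSY_IIB_at kpar kperp \<phi> (\<alpha> c) (\<omega> c) (\<Omega> c) (H c) x))"

end

theory Submission
  imports Defs
begin

text \<open>
  The proof rests on two facts about a solution: \<open>Re \<alpha>\<close> and \<open>Im \<alpha>\<close> are closed, and \<open>\<alpha>\<close> is a nowhere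
  vanishing \<open>(1,0)\<close>-form. The latter makes \<open>\<alpha>\<close> map each tangent space onto the complex plane, so
  for \<open>z \<noteq> 0\<close> the real closed 1-form \<open>Re (cnj z * \<alpha>)\<close> vanishes at no point. It
  is therefore not exact: a primitive would attain its maximum on the compact manifold, and its
  differential would vanish there. Hence no real line of the complex plane contains all the periods
  of \<open>\<alpha>\<close> over loops (\<open>SUSY_IIB_periods_span_plane\<close>). If the first Betti number were at most 1, any
  two loops would satisfy a nontrivial integral relation in homology, hence so would their periods
  (\<open>dependent_periods_of_betti_number_lt_2\<close>), and pairwise integrally dependent complex numbers do
  lie on a line. If the manifold is simply connected, all periods are 0.

  Periods over merely continuous loops and singular simplices are needed, so they are defined
  without line integrals. By the Poincare lemma \<open>\<alpha>\<close> has a primitive \<open>F\<close> near each point \<open>p\<close>; all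
  that is kept of it is the increment \<open>d p q = F q - F p\<close>, for \<open>q\<close> near \<open>p\<close>. Since two local
  primitives differ by a local constant, \<open>d p r = d p q + d q r\<close> for \<open>q\<close> near \<open>p\<close> and \<open>r\<close> near \<open>q\<close>,
  where how near \<open>r\<close> must be may depend on \<open>q\<close>. The locale \<open>increment_cocycle\<close> derives from this
  condition alone that maps from the unit square have a primitive along them
  (\<open>primitive_along_square_exists\<close>). Homotopy invariance, the vanishing of periods on boundaries of
  singular 2-simplices, and the existence of a global primitive when all periods vanish follow.
\<close>

section \<open>Closed 1-forms as cocycles of increments\<close>

text \<open>
  Relatively open preimages, stated with membership rather than set equality so that the witness can
  be intersected with other neighbourhoods without rewriting.
\<close>
lemma preimage_open_within:
  fixes h :: "'c::topological_space \<Rightarrow> 'd::topological_space"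
  assumes "continuous_on T h" "open W"
  obtains A where "open A" "\<forall>t\<in>T. t \<in> A \<longleftrightarrow> h t \<in> W"
proof -
  have "\<exists>A. open A \<and> A \<inter> T = h -` W \<inter> T"
    using assms by (simp add: continuous_on_open_invariant)
  then obtain A where A: "open A" "A \<inter> T = h -` W \<inter> T"
    by (elim exE conjE)
  have "t \<in> A \<longleftrightarrow> h t \<in> W" if "t \<in> T" for t
    using arg_cong[OF A(2), of "\<lambda>X. t \<in> X"] that by simp
  with A(1) show thesis by (intro that ballI)
qed

text \<open>
  A closed 1-form on \<open>M\<close>, seen through the increments \<open>d p q\<close> of its local primitives. Only the
  germ of \<open>d p\<close> at \<open>p\<close> carries information; the neighbourhood \<open>V\<close> depends on \<open>q\<close> because local
  primitives need only agree up to a constant that is locally, not globally, constant on the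
  overlap of their domains.
\<close>
locale increment_cocycle =
  fixes M :: "'a::topological_space set" and d :: "'a \<Rightarrow> 'a \<Rightarrow> 'b::real_vector"
  assumes local_cocycle: "p \<in> M \<Longrightarrow> \<exists>U. open U \<and> p \<in> U \<and>
    (\<forall>q\<in>U \<inter> M. \<exists>V. open V \<and> q \<in> V \<and> (\<forall>r\<in>V \<inter> M. d p r = d p q + d q r))"
begin

text \<open>
  The pullback along \<open>\<sigma>\<close> of the closed 1-form has \<open>F\<close> as a primitive on \<open>S\<close>.
\<close>
definition primitive_along :: "('c::topological_space \<Rightarrow> 'a) \<Rightarrow> 'c set \<Rightarrow> ('c \<Rightarrow> 'b) \<Rightarrow> bool" where
  "primitive_along \<sigma> S F \<longleftrightarrow>
     (\<forall>x\<in>S. \<exists>W. open W \<and> x \<in> W \<and> (\<forall>y\<in>W \<inter> S. F y = F x + d (\<sigma> x) (\<sigma> y)))"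

lemma primitive_alongD:
  assumes "primitive_along \<sigma> S F" "x \<in> S"
  obtains W where "open W" "x \<in> W" "\<forall>y\<in>W \<inter> S. F y = F x + d (\<sigma> x) (\<sigma> y)"
  using bspec[OF assms(1)[unfolded primitive_along_def] assms(2)] by (elim exE conjE)

lemma primitive_alongI:
  assumes "\<And>x. x \<in> S \<Longrightarrow> \<exists>W. open W \<and> x \<in> W \<and> (\<forall>y\<in>W \<inter> S. F y = F x + d (\<sigma> x) (\<sigma> y))"
  shows "primitive_along \<sigma> S F"
  unfolding primitive_along_def using assms by simp

lemma primitive_along_subset:
  assumes F: "primitive_along \<sigma> S F" and T: "T \<subseteq> S"
  shows "primitive_along \<sigma> T F"
proof (rule primitive_alongI)
  fix x assume "x \<in> T"
  then have "x \<in> S" using T by (rule subsetD[rotated])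
  with F obtain W where W: "open W" "x \<in> W"
    "\<forall>y\<in>W \<inter> S. F y = F x + d (\<sigma> x) (\<sigma> y)"
    by (rule primitive_alongD)
  have "\<forall>y\<in>W \<inter> T. F y = F x + d (\<sigma> x) (\<sigma> y)"
    using W(3) T by blast
  with W(1,2) show "\<exists>W. open W \<and> x \<in> W \<and> (\<forall>y\<in>W \<inter> T. F y = F x + d (\<sigma> x) (\<sigma> y))"
    by (intro exI conjI)
qed

lemma primitive_along_compose:
  assumes F: "primitive_along \<sigma> S F" and h: "continuous_on T h" "h ` T \<subseteq> S"
  shows "primitive_along (\<lambda>t. \<sigma> (h t)) T (\<lambda>t. F (h t))"
proof (rule primitive_alongI)
  fix t assume t: "t \<in> T"
  have hS: "h u \<in> S" if "u \<in> T" for u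
    using h(2) that by auto
  obtain W where W: "open W" "h t \<in> W"
    "\<forall>y\<in>W \<inter> S. F y = F (h t) + d (\<sigma> (h t)) (\<sigma> y)"
    using F hS[OF t] by (rule primitive_alongD)
  obtain A where A: "open A" "\<forall>u\<in>T. u \<in> A \<longleftrightarrow> h u \<in> W"
    using h(1) W(1) by (rule preimage_open_within)
  show "\<exists>A. open A \<and> t \<in> A \<and> (\<forall>y\<in>A \<inter> T. F (h y) = F (h t) + d (\<sigma> (h t)) (\<sigma> (h y)))"
  proof (intro exI conjI ballI)
    fix u assume u: "u \<in> A \<inter> T"
    then have "h u \<in> W \<inter> S"
      using A(2) hS by auto
    then show "F (h u) = F (h t) + d (\<sigma> (h t)) (\<sigma> (h u))"
      by (rule bspec[OF W(3)])
  qed (use A t W(2) in auto)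
qed

text \<open>
  The difference of two primitives is locally constant.
\<close>
lemma primitive_along_unique:
  assumes F: "primitive_along \<sigma> S F" and G: "primitive_along \<sigma> S G"
    and S: "connected S" "x \<in> S" "y \<in> S"
  shows "F y - F x = G y - G x"
proof -
  have "F x - G x = F y - G y"
  proof (rule connected_local_const[where f = "\<lambda>x. F x - G x", OF S], rule ballI)
    fix z assume z: "z \<in> S"
    obtain W where W: "open W" "z \<in> W"
      "\<forall>y\<in>W \<inter> S. F y = F z + d (\<sigma> z) (\<sigma> y)"
      using F z by (rule primitive_alongD)
    obtain W' where W': "open W'" "z \<in> W'"
      "\<forall>y\<in>W' \<inter> S. G y = G z + d (\<sigma> z) (\<sigma> y)"
      using G z by (rule primitive_alongD)
    show "\<forall>\<^sub>F y in at z within S. F z - G z = F y - G y"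
      unfolding eventually_at_topological
    proof (intro exI conjI ballI impI)
      fix y assume "y \<in> W \<inter> W'" "y \<in> S"
      then have "F y = F z + d (\<sigma> z) (\<sigma> y)" "G y = G z + d (\<sigma> z) (\<sigma> y)"
        using bspec[OF W(3)] bspec[OF W'(3)] by simp_all
      then show "F z - G z = F y - G y"
        by simp
    qed (use W W' in auto)
  qed
  then show ?thesis
    by (simp add: algebra_simps)
qed

text \<open>
  Near \<open>x\<close> the increment \<open>d (\<sigma> x)\<close> based at the fixed point \<open>\<sigma> x\<close> is itself a primitive; this is
  exactly what the cocycle condition says.
\<close>
lemma primitive_along_local:
  assumes \<sigma>: "continuous_on S \<sigma>" "\<sigma> ` S \<subseteq> M" and x: "x \<in> S"
  obtains W F where "open W" "x \<in> W" "primitive_along \<sigma> (S \<inter> W) F"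
proof -
  have \<sigma>M: "\<sigma> y \<in> M" if "y \<in> S" for y
    using \<sigma>(2) that by auto
  obtain U where U: "open U" "\<sigma> x \<in> U" "\<And>q. q \<in> U \<Longrightarrow> q \<in> M \<Longrightarrow>
      \<exists>V. open V \<and> q \<in> V \<and> (\<forall>r\<in>V \<inter> M. d (\<sigma> x) r = d (\<sigma> x) q + d q r)"
    using local_cocycle[OF \<sigma>M[OF x]] by (elim exE conjE) simp
  obtain W where W: "open W" "\<forall>y\<in>S. y \<in> W \<longleftrightarrow> \<sigma> y \<in> U"
    using \<sigma>(1) U(1) by (rule preimage_open_within)
  have "primitive_along \<sigma> (S \<inter> W) (\<lambda>y. d (\<sigma> x) (\<sigma> y))"
  proof (rule primitive_alongI)
    fix y assume "y \<in> S \<inter> W"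
    then have y: "y \<in> S" "\<sigma> y \<in> U"
      using W(2) by auto
    obtain V where V: "open V" "\<sigma> y \<in> V"
      "\<And>r. r \<in> V \<Longrightarrow> r \<in> M \<Longrightarrow> d (\<sigma> x) r = d (\<sigma> x) (\<sigma> y) + d (\<sigma> y) r"
      using U(3)[OF y(2) \<sigma>M[OF y(1)]] by (elim exE conjE) simp
    obtain B where B: "open B" "\<forall>y\<in>S. y \<in> B \<longleftrightarrow> \<sigma> y \<in> V"
      using \<sigma>(1) V(1) by (rule preimage_open_within)
    show "\<exists>B. open B \<and> y \<in> B \<and>
        (\<forall>z\<in>B \<inter> (S \<inter> W). d (\<sigma> x) (\<sigma> z) = d (\<sigma> x) (\<sigma> y) + d (\<sigma> y) (\<sigma> z))"
    proof (intro exI conjI ballI)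
      fix z assume "z \<in> B \<inter> (S \<inter> W)"
      then have "\<sigma> z \<in> V" "\<sigma> z \<in> M"
        using B(2) \<sigma>M by auto
      then show "d (\<sigma> x) (\<sigma> z) = d (\<sigma> x) (\<sigma> y) + d (\<sigma> y) (\<sigma> z)"
        by (rule V(3))
    qed (use B y V(2) in auto)
  qed
  moreover have "x \<in> W"
    using W(2) U(2) x by simp
  ultimately show thesis
    using W(1) that by simp
qed

lemma primitive_along_add_const:
  assumes F: "primitive_along \<sigma> S F" and H: "\<And>x. x \<in> S \<Longrightarrow> H x = F x + k"
  shows "primitive_along \<sigma> S H"
proof (rule primitive_alongI)
  fix x assume x: "x \<in> S"
  with F obtain W where W: "open W" "x \<in> W" "\<forall>y\<in>W \<inter> S. F y = F x + d (\<sigma> x) (\<sigma> y)"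
    by (rule primitive_alongD)
  show "\<exists>W. open W \<and> x \<in> W \<and> (\<forall>y\<in>W \<inter> S. H y = H x + d (\<sigma> x) (\<sigma> y))"
  proof (intro exI conjI ballI)
    fix y assume y: "y \<in> W \<inter> S"
    then have "F y = F x + d (\<sigma> x) (\<sigma> y)"
      by (rule bspec[OF W(3)])
    then show "H y = H x + d (\<sigma> x) (\<sigma> y)"
      using H[OF x] H[of y] y by (simp add: ac_simps)
  qed (use W(1,2) in auto)
qed

text \<open>
  For closed \<open>S\<close> the condition also holds, vacuously, at points outside \<open>S\<close>. This removes the
  case distinction when primitives on two closed sets are glued.
\<close>
lemma primitive_along_closedD:
  assumes F: "primitive_along \<sigma> S F" and "closed S"
  obtains W where "open W" "x \<in> W" "\<forall>y\<in>W \<inter> S. F y = F x + d (\<sigma> x) (\<sigma> y)"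
proof (cases "x \<in> S")
  case True
  with F that show thesis
    by (elim primitive_alongD)
next
  case False
  with \<open>closed S\<close> show thesis
    by (intro that[of "- S"]) auto
qed

text \<open>
  On the connected intersection the two primitives differ by one constant, which is absorbed into
  the second. Closedness of both sets makes the neighbourhoods of a point in either set combine to a
  neighbourhood in the union.
\<close>
lemma primitive_along_glue:
  assumes "closed S" "closed T" and conn: "connected (S \<inter> T)"
    and F: "primitive_along \<sigma> S F" and G: "primitive_along \<sigma> T G"
  shows "\<exists>H. primitive_along \<sigma> (S \<union> T) H"
proof -
  obtain k where k: "\<And>x. x \<in> S \<inter> T \<Longrightarrow> F x = G x + k"
  proof (cases "S \<inter> T = {}")
    case False
    then obtain a where a: "a \<in> S \<inter> T" by blast
    have FG: "primitive_along \<sigma> (S \<inter> T) F" "primitive_along \<sigma> (S \<inter> T) G"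
      by (rule primitive_along_subset[OF F], simp) (rule primitive_along_subset[OF G], simp)
    have "F x = G x + (F a - G a)" if "x \<in> S \<inter> T" for x
      using primitive_along_unique[OF FG conn a that] by (simp add: diff_eq_eq add_diff_eq diff_add_eq)
    then show thesis
      by (rule that)
  next
    case True
    show thesis
      by (rule that[of 0]) (simp add: True)
  qed
  define H where "H x = (if x \<in> S then F x else G x + k)" for x
  have HS: "primitive_along \<sigma> S H"
    by (rule primitive_along_add_const[OF F, of _ 0]) (simp add: H_def)
  have HT: "primitive_along \<sigma> T H"
    by (rule primitive_along_add_const[OF G, of _ k]) (simp add: H_def k)
  have "\<exists>W. open W \<and> x \<in> W \<and> (\<forall>y\<in>W \<inter> (S \<union> T). H y = H x + d (\<sigma> x) (\<sigma> y))" for x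
  proof -
    obtain W where W: "open W" "x \<in> W" "\<forall>y\<in>W \<inter> S. H y = H x + d (\<sigma> x) (\<sigma> y)"
      using HS \<open>closed S\<close> by (rule primitive_along_closedD)
    obtain W' where W': "open W'" "x \<in> W'" "\<forall>y\<in>W' \<inter> T. H y = H x + d (\<sigma> x) (\<sigma> y)"
      using HT \<open>closed T\<close> by (rule primitive_along_closedD)
    show ?thesis
    proof (intro exI conjI ballI)
      fix y assume "y \<in> (W \<inter> W') \<inter> (S \<union> T)"
      then have "y \<in> W \<inter> S \<or> y \<in> W' \<inter> T"
        by auto
      then show "H y = H x + d (\<sigma> x) (\<sigma> y)"
        by (elim disjE bspec[OF W(3)] bspec[OF W'(3)])
    qed (use W(1,2) W'(1,2) in auto)
  qed
  then show ?thesis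
    by (intro exI[of _ H] primitive_alongI)
qed

text \<open>
  Small rectangles have a primitive by local existence, and adjacent rectangles can be glued along
  their common edge, which is connected. Bisection in the second coordinate yields strips over short
  intervals, bisection in the first coordinate then yields the square.
\<close>
lemma primitive_along_square_exists:
  fixes \<sigma> :: "real \<times> real \<Rightarrow> 'a"
  assumes \<sigma>: "continuous_on ({0..1} \<times> {0..1}) \<sigma>" "\<sigma> ` ({0..1} \<times> {0..1}) \<subseteq> M"
  shows "\<exists>F. primitive_along \<sigma> ({0..1} \<times> {0..1}) F"
proof -
  define Q :: "(real \<times> real) set" where "Q = {0..1} \<times> {0..1}"
  define P where "P a b c e \<longleftrightarrow> (\<exists>F. primitive_along \<sigma> (Q \<inter> ({a..b} \<times> {c..e})) F)" for a b c e
  have clQ: "closed (Q \<inter> ({a..b} \<times> {c..e}))" for a b c e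
    unfolding Q_def by (intro closed_Int closed_Times) auto
  have cnQ: "connected (Q \<inter> ({a..b} \<times> {c..e}))" for a b c e
    unfolding Q_def by (intro convex_connected convex_Int convex_Times) auto
  have glue_vertical: "P a b c e" if "P a b c m" "P a b m e" "c \<le> m" "m \<le> e" for a b c m e
  proof -
    have "(Q \<inter> ({a..b} \<times> {c..m})) \<union> (Q \<inter> ({a..b} \<times> {m..e})) = Q \<inter> ({a..b} \<times> {c..e})"
      "(Q \<inter> ({a..b} \<times> {c..m})) \<inter> (Q \<inter> ({a..b} \<times> {m..e})) = Q \<inter> ({a..b} \<times> {m..m})"
      using that(3,4) by auto
    with that(1,2) show ?thesis
      unfolding P_def by (elim exE) (drule (1) primitive_along_glue[OF clQ clQ, rotated], simp_all only: cnQ)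
  qed
  have glue_horizontal: "P a b c e" if "P a m c e" "P m b c e" "a \<le> m" "m \<le> b" for a b c m e
  proof -
    have "(Q \<inter> ({a..m} \<times> {c..e})) \<union> (Q \<inter> ({m..b} \<times> {c..e})) = Q \<inter> ({a..b} \<times> {c..e})"
      "(Q \<inter> ({a..m} \<times> {c..e})) \<inter> (Q \<inter> ({m..b} \<times> {c..e})) = Q \<inter> ({m..m} \<times> {c..e})"
      using that(3,4) by auto
    with that(1,2) show ?thesis
      unfolding P_def by (elim exE) (drule (1) primitive_along_glue[OF clQ clQ, rotated], simp_all only: cnQ)
  qed
  have small: "\<exists>\<delta>>0. \<forall>a b c e. a \<le> x \<and> x \<le> b \<and> b - a < \<delta> \<and> c \<le> y \<and> y \<le> e \<and> e - c < \<delta> \<longrightarrow> P a b c e"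
    if xy: "(x, y) \<in> Q" for x y
  proof -
    obtain W F where W: "open W" "(x, y) \<in> W" "primitive_along \<sigma> (Q \<inter> W) F"
      using primitive_along_local[OF \<sigma> xy[unfolded Q_def]] unfolding Q_def by blast
    obtain \<delta> where \<delta>: "\<delta> > 0" "ball (x, y) \<delta> \<subseteq> W"
      using W(1,2) open_contains_ball by blast
    have sub: "{a..b} \<times> {c..e} \<subseteq> W"
      if "a \<le> x" "x \<le> b" "b - a < \<delta>/2" "c \<le> y" "y \<le> e" "e - c < \<delta>/2" for a b c e
    proof
      fix z assume z: "z \<in> {a..b} \<times> {c..e}"
      have "dist (x, y) z \<le> dist x (fst z) + dist y (snd z)"
        unfolding dist_prod_def by (simp add: sqrt_sum_squares_le_sum)
      also have "\<dots> < \<delta>"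
        using z that by (auto simp: dist_real_def)
      finally show "z \<in> W"
        using \<delta>(2) by auto
    qed
    show ?thesis
    proof (intro exI[of _ "\<delta>/2"] conjI allI impI)
      fix a b c e
      assume "a \<le> x \<and> x \<le> b \<and> b - a < \<delta>/2 \<and> c \<le> y \<and> y \<le> e \<and> e - c < \<delta>/2"
      then have "{a..b} \<times> {c..e} \<subseteq> W"
        using sub by simp
      then have "Q \<inter> ({a..b} \<times> {c..e}) \<subseteq> Q \<inter> W"
        by (rule Int_mono[OF subset_refl])
      from primitive_along_subset[OF W(3) this] show "P a b c e"
        unfolding P_def by blast
    qed (use \<delta>(1) in simp)
  qed
  have strip: "\<exists>\<delta>>0. \<forall>a b. a \<le> x \<and> x \<le> b \<and> b - a < \<delta> \<longrightarrow> P a b 0 1" if x: "0 \<le> x" "x \<le> 1" for x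
  proof (rule Bolzano[of 0 1 "\<lambda>c e. \<exists>\<delta>>0. \<forall>a b. a \<le> x \<and> x \<le> b \<and> b - a < \<delta> \<longrightarrow> P a b c e"])
    fix c m e :: real
    assume 1: "\<exists>\<delta>>0. \<forall>a b. a \<le> x \<and> x \<le> b \<and> b - a < \<delta> \<longrightarrow> P a b c m"
      and 2: "\<exists>\<delta>>0. \<forall>a b. a \<le> x \<and> x \<le> b \<and> b - a < \<delta> \<longrightarrow> P a b m e"
      and 3: "c \<le> m" "m \<le> e"
    obtain \<delta> \<delta>' where "\<delta> > 0" "\<forall>a b. a \<le> x \<and> x \<le> b \<and> b - a < \<delta> \<longrightarrow> P a b c m"
      and "\<delta>' > 0" "\<forall>a b. a \<le> x \<and> x \<le> b \<and> b - a < \<delta>' \<longrightarrow> P a b m e"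
      using 1 2 by blast
    then show "\<exists>\<delta>>0. \<forall>a b. a \<le> x \<and> x \<le> b \<and> b - a < \<delta> \<longrightarrow> P a b c e"
      using glue_vertical[OF _ _ 3] by (intro exI[of _ "min \<delta> \<delta>'"]) auto
  next
    fix y :: real assume "0 \<le> y" "y \<le> 1"
    then have "(x, y) \<in> Q" using x by (auto simp: Q_def)
    from small[OF this] obtain \<delta> where "\<delta> > 0" "\<forall>a b c e. a \<le> x \<and> x \<le> b \<and> b - a < \<delta> \<and> c \<le> y \<and> y \<le> e \<and> e - c < \<delta> \<longrightarrow> P a b c e"
      by blast
    then show "\<exists>\<epsilon>>0. \<forall>c e. c \<le> y \<and> y \<le> e \<and> e - c < \<epsilon> \<longrightarrow>
        (\<exists>\<delta>>0. \<forall>a b. a \<le> x \<and> x \<le> b \<and> b - a < \<delta> \<longrightarrow> P a b c e)"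
      by (intro exI[of _ \<delta>]) auto
  qed auto
  have "P 0 1 0 1"
    by (rule Bolzano[of 0 1 "\<lambda>a b. P a b 0 1"]) (use strip glue_horizontal in auto)
  then show ?thesis
    unfolding P_def Q_def by simp
qed

text \<open>
  A path is a map on the square that does not depend on the second coordinate.
\<close>
lemma primitive_along_path_exists:
  assumes "path \<gamma>" "path_image \<gamma> \<subseteq> M"
  shows "\<exists>F. primitive_along \<gamma> {0..1} F"
proof -
  have "continuous_on ({0..1} \<times> {0..1}) (\<lambda>z::real \<times> real. \<gamma> (fst z))"
    using assms(1) unfolding path_def
    by (rule continuous_on_compose2) (intro continuous_intros, auto)
  then obtain F where "primitive_along (\<lambda>z::real \<times> real. \<gamma> (fst z)) ({0..1} \<times> {0..1}) F"
    using primitive_along_square_exists[of "\<lambda>z. \<gamma> (fst z)"] assms(2)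
    by (auto simp: path_image_def image_subset_iff)
  moreover have "continuous_on {0..1} (\<lambda>t::real. (t, 0::real))"
    by (intro continuous_intros)
  ultimately have "primitive_along (\<lambda>t. \<gamma> (fst (t, 0::real))) {0..1} (\<lambda>t. F (t, 0))"
    by (rule primitive_along_compose) auto
  then show ?thesis
    by auto
qed

text \<open>
  The integral of the closed 1-form along a continuous path.
\<close>
definition period :: "(real \<Rightarrow> 'a) \<Rightarrow> 'b" where
  "period \<gamma> = (let F = SOME F. primitive_along \<gamma> {0..1} F in F 1 - F 0)"

lemma period_eq:
  assumes "primitive_along \<gamma> {0..1} F"
  shows "period \<gamma> = F 1 - F 0"
  unfolding period_def Let_def
  by (rule primitive_along_unique[OF someI[of "primitive_along \<gamma> {0..1}", OF assms] assms]) auto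

text \<open>
  The Stokes theorem for the square: a primitive along the square is single-valued at its corners.
\<close>
lemma period_square:
  assumes \<sigma>: "continuous_on ({0..1} \<times> {0..1}) \<sigma>" "\<sigma> ` ({0..1} \<times> {0..1}) \<subseteq> M"
  shows "period (\<lambda>t. \<sigma> (0, t)) + period (\<lambda>s. \<sigma> (s, 1)) = period (\<lambda>s. \<sigma> (s, 0)) + period (\<lambda>t. \<sigma> (1, t))"
proof -
  obtain F where F: "primitive_along \<sigma> ({0..1} \<times> {0..1}) F"
    using primitive_along_square_exists[OF \<sigma>] by blast
  have e: "period (\<lambda>t. \<sigma> (h t)) = F (h 1) - F (h 0)"
    if "continuous_on {0..1} h" "h ` {0..1} \<subseteq> {0..1} \<times> {0..1}" for h
    by (rule period_eq[OF primitive_along_compose[OF F that]])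
  have "period (\<lambda>t. \<sigma> (0, t)) = F (0, 1) - F (0, 0)" "period (\<lambda>s. \<sigma> (s, 1)) = F (1, 1) - F (0, 1)"
    "period (\<lambda>s. \<sigma> (s, 0)) = F (1, 0) - F (0, 0)" "period (\<lambda>t. \<sigma> (1, t)) = F (1, 1) - F (1, 0)"
    by (rule e; (intro continuous_intros)?; auto)+
  then show ?thesis by simp
qed

text \<open>
  Allowing \<open>b \<le> a\<close> covers reversal and constant paths as well as the halves of a joined path.
\<close>
lemma period_affine_part:
  assumes \<gamma>: "path \<gamma>" "path_image \<gamma> \<subseteq> M" and F: "primitive_along \<gamma> {0..1} F"
    and ab: "a \<in> {0..1}" "b \<in> {0..1}"
  shows "period (\<lambda>t. \<gamma> ((1 - t) * a + t * b)) = F b - F a"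
proof -
  have "(\<lambda>t. (1 - t) * a + t * b) ` {0..1} \<subseteq> {0..1}"
    using ab convex_real_interval(5)[of 0 1] unfolding convex_alt by auto
  moreover have "continuous_on {0..1} (\<lambda>t. (1 - t) * a + t * b)"
    by (intro continuous_intros)
  ultimately show ?thesis
    using period_eq[OF primitive_along_compose[OF F]] by simp
qed

lemma period_reversepath:
  assumes "path \<gamma>" "path_image \<gamma> \<subseteq> M"
  shows "period (reversepath \<gamma>) = - period \<gamma>"
proof -
  obtain F where F: "primitive_along \<gamma> {0..1} F"
    using primitive_along_path_exists[OF assms] by blast
  show ?thesis
    using period_affine_part[OF assms F, of 1 0] period_eq[OF F] by (simp add: reversepath_def)
qed

lemma period_const:
  assumes "p \<in> M"
  shows "period (\<lambda>_. p) = 0"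
proof -
  have *: "path (\<lambda>_::real. p)" "path_image (\<lambda>_::real. p) \<subseteq> M"
    using assms by (auto simp: path_image_def path_def)
  then obtain F where "primitive_along (\<lambda>_. p) {0..1::real} F"
    using primitive_along_path_exists by blast
  from period_affine_part[OF * this, of 0 0] show ?thesis by simp
qed

lemma period_cong: "(\<And>t. t \<in> {0..1} \<Longrightarrow> \<gamma> t = \<delta> t) \<Longrightarrow> period \<gamma> = period \<delta>"
proof -
  assume *: "\<And>t. t \<in> {0..1} \<Longrightarrow> \<gamma> t = \<delta> t"
  have "primitive_along \<gamma> {0..1} F \<longleftrightarrow> primitive_along \<delta> {0..1} F" for F
    unfolding primitive_along_def by (intro ball_cong ex_cong1 conj_cong refl) (simp add: *)
  then show ?thesis
    by (simp add: period_def)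
qed

lemma period_joinpaths:
  assumes \<gamma>: "path \<gamma>" "path_image \<gamma> \<subseteq> M" and \<delta>: "path \<delta>" "path_image \<delta> \<subseteq> M"
    and j: "pathfinish \<gamma> = pathstart \<delta>"
  shows "period (\<gamma> +++ \<delta>) = period \<gamma> + period \<delta>"
proof -
  have *: "path (\<gamma> +++ \<delta>)" "path_image (\<gamma> +++ \<delta>) \<subseteq> M"
    using assms by (auto simp: path_image_join)
  obtain F where F: "primitive_along (\<gamma> +++ \<delta>) {0..1} F"
    using primitive_along_path_exists[OF *] by blast
  have "period \<gamma> = F (1/2) - F 0"
    using period_affine_part[OF * F, of 0 "1/2"]
    by (subst period_cong[of \<gamma> "\<lambda>t. (\<gamma> +++ \<delta>) ((1 - t) * 0 + t * (1/2))"]) (auto simp: joinpaths_def)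
  moreover have "period \<delta> = F 1 - F (1/2)"
  proof -
    have "(\<gamma> +++ \<delta>) ((1 - t) * (1/2) + t * 1) = \<delta> t" if "t \<in> {0..1}" for t
    proof (cases "t = 0")
      case True
      then show ?thesis using j by (simp add: joinpaths_def pathfinish_def pathstart_def)
    next
      case False
      have eq: "(1 - t) * (1/2) + t * 1 = (t + 1) / 2" by (simp add: field_simps)
      have "2 * ((t + 1) / 2) - 1 = t"
        by (simp add: field_simps)
      moreover have "\<not> (t + 1) / 2 \<le> 1 / 2"
        using False that by auto
      ultimately show ?thesis unfolding eq joinpaths_def by (simp only: if_False)
    qed
    then show ?thesis
      using period_affine_part[OF * F, of "1/2" 1]
      by (subst period_cong[of \<delta> "\<lambda>t. (\<gamma> +++ \<delta>) ((1 - t) * (1/2) + t * 1)"]) auto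
  qed
  ultimately show ?thesis
    using period_eq[OF F] by simp
qed

end

section \<open>Linear images of increments\<close>

text \<open>
  Real-linear images of a closed complex 1-form are closed; they are needed for the real part of a
  complex multiple.
\<close>
lemma (in increment_cocycle) increment_cocycle_linear:
  assumes L: "linear L"
  shows "increment_cocycle M (\<lambda>p q. L (d p q))"
proof
  fix p assume "p \<in> M"
  then obtain U where U: "open U" "p \<in> U"
    "\<forall>q\<in>U \<inter> M. \<exists>V. open V \<and> q \<in> V \<and> (\<forall>r\<in>V \<inter> M. d p r = d p q + d q r)"
    using local_cocycle by blast
  have "\<exists>V. open V \<and> q \<in> V \<and> (\<forall>r\<in>V \<inter> M. L (d p r) = L (d p q) + L (d q r))" if q: "q \<in> U \<inter> M" for q
  proof -
    obtain V where V: "open V" "q \<in> V" "\<forall>r\<in>V \<inter> M. d p r = d p q + d q r"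
      using bspec[OF U(3) q] by (elim exE conjE)
    have "L (d p r) = L (d p q) + L (d q r)" if "r \<in> V \<inter> M" for r
      by (simp only: bspec[OF V(3) that] linear_add[OF L])
    with V(1,2) show ?thesis by (intro exI conjI ballI)
  qed
  then have "\<forall>q\<in>U \<inter> M. \<exists>V. open V \<and> q \<in> V \<and> (\<forall>r\<in>V \<inter> M. L (d p r) = L (d p q) + L (d q r))"
    by (rule ballI)
  with U(1,2) show "\<exists>U. open U \<and> p \<in> U \<and>
      (\<forall>q\<in>U \<inter> M. \<exists>V. open V \<and> q \<in> V \<and> (\<forall>r\<in>V \<inter> M. L (d p r) = L (d p q) + L (d q r)))"
    by (intro exI[of _ U] conjI)
qed

lemma (in increment_cocycle) period_linear:
  assumes L: "linear L" and \<gamma>: "path \<gamma>" "path_image \<gamma> \<subseteq> M"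
  shows "increment_cocycle.period (\<lambda>p q. L (d p q)) \<gamma> = L (period \<gamma>)"
proof -
  interpret L: increment_cocycle M "\<lambda>p q. L (d p q)"
    by (rule increment_cocycle_linear[OF L])
  obtain F where F: "primitive_along \<gamma> {0..1} F"
    using primitive_along_path_exists[OF \<gamma>] by blast
  have "L.primitive_along \<gamma> {0..1} (\<lambda>t. L (F t))"
  proof (rule L.primitive_alongI)
    fix x :: real assume "x \<in> {0..1}"
    with F obtain W where W: "open W" "x \<in> W" "\<forall>y\<in>W \<inter> {0..1}. F y = F x + d (\<gamma> x) (\<gamma> y)"
      by (rule primitive_alongD)
    have "L (F y) = L (F x) + L (d (\<gamma> x) (\<gamma> y))" if "y \<in> W \<inter> {0..1}" for y
      by (simp only: bspec[OF W(3) that] linear_add[OF L])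
    with W(1,2) show "\<exists>W. open W \<and> x \<in> W \<and> (\<forall>y\<in>W \<inter> {0..1}. L (F y) = L (F x) + L (d (\<gamma> x) (\<gamma> y)))"
      by (intro exI conjI ballI)
  qed
  from L.period_eq[OF this] show ?thesis
    using period_eq[OF F] by (simp only: linear_diff[OF L])
qed

section \<open>Relations in homology groups of small rank\<close>

text \<open>
  Passing to homology classes is a homomorphism from the group of cycles, in which powers are integral
  multiples.
\<close>
lemma homologous_rel_set_pow:
  assumes "singular_relcycle p X S c"
  shows "homologous_rel_set p X S c [^]\<^bsub>relative_homology_group (int p) X S\<^esub> (n::int)
       = homologous_rel_set p X S (frag_cmul n c)"
proof -
  let ?Z = "relcycle_group p X S" and ?B = "singular_relboundary_set p X S"
  have hom: "(\<lambda>a. ?B #>\<^bsub>?Z\<^esub> a) \<in> hom ?Z (relative_homology_group (int p) X S)"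
    unfolding nontrivial_relative_homology_group
    by (rule normal.r_coset_hom_Mod[OF normal_subgroup_singular_relboundary_relcycle])
  have c: "c \<in> carrier ?Z"
    using assms by simp
  have keys: "Poly_Mapping.keys c \<subseteq> singular_simplex_set p X"
    using assms by (simp add: singular_relcycle singular_chain_def)
  have "c [^]\<^bsub>?Z\<^esub> n = c [^]\<^bsub>chain_group p X\<^esub> n"
    using c unfolding relcycle_group_def by (rule group.int_pow_subgroup_generated[OF group_chain_group])
  also have "\<dots> = frag_cmul n c"
    using keys by (simp add: chain_group_def)
  finally have "c [^]\<^bsub>?Z\<^esub> n = frag_cmul n c" .
  with hom_int_pow[OF hom c group_relcycle_group group_relative_homology_group, of n]
  show ?thesis
    by (simp add: right_coset_singular_relboundary)
qed

lemma homologous_rel_set_mult: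
  assumes "singular_relcycle p X S a" "singular_relcycle p X S b"
  shows "homologous_rel_set p X S a \<otimes>\<^bsub>relative_homology_group (int p) X S\<^esub> homologous_rel_set p X S b
       = homologous_rel_set p X S (a + b)"
proof -
  let ?Z = "relcycle_group p X S" and ?B = "singular_relboundary_set p X S"
  have hom: "(\<lambda>a. ?B #>\<^bsub>?Z\<^esub> a) \<in> hom ?Z (relative_homology_group (int p) X S)"
    unfolding nontrivial_relative_homology_group
    by (rule normal.r_coset_hom_Mod[OF normal_subgroup_singular_relboundary_relcycle])
  show ?thesis
    using hom_mult[OF hom, of a b] assms by (simp add: right_coset_singular_relboundary)
qed

text \<open>
  If the two classes coincide, the set of both has one element and its
  independence says nothing about the pair; in that case the difference of the cycles is already a boundary.
\<close>
lemma betti_number_lt_2_imp_relation: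
  assumes betti: "\<not> 2 \<le> betti_number p X"
    and a: "singular_relcycle p X {} a" and b: "singular_relcycle p X {} b"
  shows "\<exists>n m. (n \<noteq> 0 \<or> m \<noteq> 0) \<and> singular_relboundary p X {} (frag_cmul n a + frag_cmul m b)"
proof -
  let ?G = "homology_group (int p) X" and ?h = "homologous_rel_set p X {}"
  interpret G: comm_group ?G
    by (rule abelian_homology_group)
  have carr: "?h a \<in> carrier ?G" "?h b \<in> carrier ?G"
    using a b by (auto simp: carrier_relative_homology_group)
  show ?thesis
  proof (cases "?h a = ?h b")
    case True
    then have "homologous_rel p X {} a b"
      by (simp only: homologous_rel_set_eq)
    then have "singular_relboundary p X {} (a - b)"
      by (simp only: homologous_rel_def)
    then show ?thesis
      by (intro exI[of _ 1] exI[of _ "-1"]) simp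
  next
    case False
    have "\<not> int_independent ?G {?h a, ?h b}"
    proof
      assume "int_independent ?G {?h a, ?h b}"
      then have "enat (card {?h a, ?h b}) \<in> {enat (card S) |S. int_independent ?G S}"
        by blast
      then have "enat (card {?h a, ?h b}) \<le> betti_number p X"
        unfolding betti_number_def abelian_rank_def by (rule Sup_upper)
      with False betti show False
        by (simp add: numeral_eq_enat numeral_2_eq_2)
    qed
    then obtain k :: "_ \<Rightarrow> int" where
      k: "finprod ?G (\<lambda>s. s [^]\<^bsub>?G\<^esub> k s) {?h a, ?h b} = \<one>\<^bsub>?G\<^esub>" "k (?h a) \<noteq> 0 \<or> k (?h b) \<noteq> 0"
      using carr unfolding int_independent_def by auto
    define n m where "n = k (?h a)" and "m = k (?h b)"
    have "finprod ?G (\<lambda>s. s [^]\<^bsub>?G\<^esub> k s) {?h a, ?h b} = ?h a [^]\<^bsub>?G\<^esub> n \<otimes>\<^bsub>?G\<^esub> ?h b [^]\<^bsub>?G\<^esub> m"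
      using False carr unfolding n_def m_def by (simp del: one_relative_homology_group)
    also have "\<dots> = ?h (frag_cmul n a + frag_cmul m b)"
      using a b by (simp add: homologous_rel_set_pow homologous_rel_set_mult singular_relcycle_cmul)
    finally have "?h (frag_cmul n a + frag_cmul m b) = singular_relboundary_set p X {}"
      using k(1) by simp
    then have "singular_relboundary p X {} (frag_cmul n a + frag_cmul m b)"
      by (simp only: homologous_rel_set_eq_relboundary)
    with k(2) show ?thesis
      unfolding n_def m_def by blast
  qed
qed

section \<open>Periods on singular chains, homotopies and global primitives\<close>

text \<open>
  The path along a singular 1-simplex, in barycentric coordinates, from its vertex 0 to its vertex 1.
\<close>
definition edge_path :: "((nat \<Rightarrow> real) \<Rightarrow> 'a) \<Rightarrow> real \<Rightarrow> 'a" where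
  "edge_path f t = f (\<lambda>i. if i = 0 then 1 - t else if i = 1 then t else 0)"

definition loop_simplex :: "(real \<Rightarrow> 'a) \<Rightarrow> (nat \<Rightarrow> real) \<Rightarrow> 'a" where
  "loop_simplex \<gamma> = restrict (\<lambda>x. \<gamma> (x 1)) (standard_simplex 1)"

lemma edge_point_in_standard_simplex:
  "t \<in> {0..1} \<Longrightarrow> (\<lambda>i. if i = 0 then 1 - t else if i = 1 then t else 0) \<in> standard_simplex 1"
  by (simp add: standard_simplex_def)

lemma edge_path_loop_simplex:
  "t \<in> {0..1} \<Longrightarrow> edge_path (loop_simplex \<gamma>) t = \<gamma> t"
  using edge_point_in_standard_simplex[of t] by (simp add: edge_path_def loop_simplex_def)

lemma singular_simplex_top_of_set:
  fixes M :: "'a::topological_space set"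
  shows "singular_simplex p (top_of_set M) f \<longleftrightarrow>
     continuous_on (standard_simplex p) f \<and> f ` standard_simplex p \<subseteq> M \<and> f \<in> extensional (standard_simplex p)"
  unfolding singular_simplex_def euclidean_product_topology
  by (auto simp: continuous_map_in_subtopology)

text \<open>
  The two faces of the simplex are the end points of the loop.
\<close>
lemma singular_cycle_loop_simplex:
  fixes M :: "'a::topological_space set"
  assumes \<gamma>: "path \<gamma>" "path_image \<gamma> \<subseteq> M" "pathfinish \<gamma> = pathstart \<gamma>"
  shows "singular_relcycle 1 (top_of_set M) {} (frag_of (loop_simplex \<gamma>))"
proof -
  have x1: "x 1 \<in> {0..1}" if "x \<in> standard_simplex 1" for x :: "nat \<Rightarrow> real"
    using that by (auto simp: standard_simplex_def)
  have "continuous_on (standard_simplex 1) (\<lambda>x. \<gamma> (x 1))"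
    using \<gamma>(1) unfolding path_def
    by (rule continuous_on_compose2) (use x1 in \<open>auto intro: continuous_on_product_coordinates continuous_on_subset\<close>)
  then have "continuous_on (standard_simplex 1) (loop_simplex \<gamma>)"
    unfolding loop_simplex_def by (simp cong: continuous_on_cong)
  moreover have "loop_simplex \<gamma> ` standard_simplex 1 \<subseteq> M"
    using \<gamma>(2) x1 by (auto simp: loop_simplex_def path_image_def)
  ultimately have "singular_simplex 1 (top_of_set M) (loop_simplex \<gamma>)"
    unfolding singular_simplex_top_of_set by (simp add: loop_simplex_def)
  moreover have "singular_face 1 0 (loop_simplex \<gamma>) = singular_face 1 1 (loop_simplex \<gamma>)"
  proof
    fix x :: "nat \<Rightarrow> real"
    show "singular_face 1 0 (loop_simplex \<gamma>) x = singular_face 1 1 (loop_simplex \<gamma>) x"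
    proof (cases "x \<in> standard_simplex 0")
      case True
      then have "simplical_face 0 x \<in> standard_simplex 1" "simplical_face 1 x \<in> standard_simplex 1"
        by (simp_all add: simplical_face_in_standard_simplex)
      with True \<gamma>(3) show ?thesis
        by (simp add: singular_face_def loop_simplex_def standard_simplex_0 simplical_face_def
            pathfinish_def pathstart_def)
    qed (simp add: singular_face_def)
  qed
  ultimately show ?thesis
    by (simp add: singular_cycle singular_chain_of chain_boundary_of)
qed

context increment_cocycle
begin

definition chain_period :: "'a chain \<Rightarrow> 'b" where
  "chain_period c = (\<Sum>f\<in>Poly_Mapping.keys c. real_of_int (Poly_Mapping.lookup c f) *\<^sub>R period (edge_path f))"

text \<open>
  A common index set makes sums of chains with different supports comparable.
\<close>
lemma chain_period_superset:
  "finite K \<Longrightarrow> Poly_Mapping.keys c \<subseteq> K \<Longrightarrow>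
     chain_period c = (\<Sum>f\<in>K. real_of_int (Poly_Mapping.lookup c f) *\<^sub>R period (edge_path f))"
  unfolding chain_period_def
  by (rule sum.mono_neutral_left) (auto simp: in_keys_iff)

lemma chain_period_of: "chain_period (frag_of f) = period (edge_path f)"
  by (simp add: chain_period_def)

lemma chain_period_0: "chain_period 0 = 0"
  by (simp add: chain_period_def)

lemma chain_period_cmul: "chain_period (frag_cmul n c) = real_of_int n *\<^sub>R chain_period c"
  by (simp add: chain_period_superset[of "Poly_Mapping.keys c"] keys_cmul scaleR_sum_right)

lemma chain_period_add: "chain_period (a + b) = chain_period a + chain_period b"
proof -
  let ?K = "Poly_Mapping.keys a \<union> Poly_Mapping.keys b"
  have "chain_period c = (\<Sum>f\<in>?K. real_of_int (Poly_Mapping.lookup c f) *\<^sub>R period (edge_path f))"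
    if "Poly_Mapping.keys c \<subseteq> ?K" for c
    using that by (intro chain_period_superset) auto
  from this[of "a + b"] this[of a] this[of b] show ?thesis
    using keys_add[of a b] by (simp add: lookup_add scaleR_add_left sum.distrib)
qed

lemma chain_period_diff: "chain_period (a - b) = chain_period a - chain_period b"
  using chain_period_add[of "a - b" b] by simp

text \<open>
  The square is mapped onto the triangle by collapsing the edge \<open>s = 0\<close> to vertex 0; the other three
  edges of the square become the three faces.
\<close>
lemma chain_period_simplex_boundary:
  assumes f: "singular_simplex 2 (top_of_set M) f"
  shows "chain_period (chain_boundary 2 (frag_of f)) = 0"
proof -
  \<comment> \<open>Barycentric coordinates of the point at ratio \<open>s\<close> on the way from vertex 0 to the point at
    ratio \<open>t\<close> on the opposite edge.\<close>
  define b :: "real \<times> real \<Rightarrow> nat \<Rightarrow> real" where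
    "b = (\<lambda>(s, t) i. if i = 0 then 1 - s else if i = 1 then s * (1 - t) else if i = 2 then s * t else 0)"
  have cb: "continuous_on ({0..1} \<times> {0..1}) b"
  proof (rule continuous_on_coordinatewise_then_product)
    fix i
    have "(\<lambda>x. b x i) = (if i = 0 then (\<lambda>x. 1 - fst x) else if i = 1 then (\<lambda>x. fst x * (1 - snd x))
        else if i = 2 then (\<lambda>x. fst x * snd x) else (\<lambda>_. 0))"
      by (auto simp: b_def fun_eq_iff)
    then show "continuous_on ({0..1} \<times> {0..1}) (\<lambda>x. b x i)"
      by (simp only: split: if_split) (intro conjI impI continuous_intros)
  qed
  have sb: "b (s, t) \<in> standard_simplex 2" if "s \<in> {0..1}" "t \<in> {0..1}" for s t
  proof -
    have "(\<Sum>i\<le>2. b (s, t) i) = 1"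
      by (simp add: b_def numeral_2_eq_2 algebra_simps)
    moreover have "0 \<le> b (s, t) i \<and> b (s, t) i \<le> 1" for i
      using that by (auto simp: b_def intro: mult_le_one)
    ultimately show ?thesis
      by (simp add: standard_simplex_def b_def)
  qed
  have cf: "continuous_on (standard_simplex 2) f" "f ` standard_simplex 2 \<subseteq> M"
    using f unfolding singular_simplex_top_of_set by auto
  have "continuous_on ({0..1} \<times> {0..1}) (\<lambda>z. f (b z))" "(\<lambda>z. f (b z)) ` ({0..1} \<times> {0..1}) \<subseteq> M"
    using sb cf(2) by (auto intro!: continuous_on_compose2[OF cf(1) cb])
  from period_square[OF this]
  have sq: "period (\<lambda>t. f (b (0, t))) + period (\<lambda>s. f (b (s, 1)))
      = period (\<lambda>s. f (b (s, 0))) + period (\<lambda>t. f (b (1, t)))" .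
  have face: "edge_path (singular_face 2 k f) t
      = f (simplical_face k (\<lambda>i. if i = 0 then 1 - t else if i = 1 then t else 0))"
    if "t \<in> {0..1}" for k t
    using edge_point_in_standard_simplex[OF that]
    by (simp add: edge_path_def singular_face_def)
  have "period (\<lambda>t. f (b (0, t))) = 0"
  proof -
    have "b (0, t) = b (0, 0)" for t
      by (simp add: b_def fun_eq_iff)
    then have "(\<lambda>t. f (b (0, t))) = (\<lambda>_. f (b (0, 0)))"
      by (metis (no_types))
    moreover have "f (b (0, 0)) \<in> M"
      using sb[of 0 0] cf(2) by auto
    ultimately show ?thesis
      by (simp only: period_const)
  qed
  moreover have "period (\<lambda>s. f (b (s, 1))) = period (edge_path (singular_face 2 1 f))"
    by (rule period_cong) (auto simp: face b_def simplical_face_def fun_eq_iff intro!: arg_cong[of _ _ f])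
  moreover have "period (\<lambda>s. f (b (s, 0))) = period (edge_path (singular_face 2 2 f))"
    by (rule period_cong) (auto simp: face b_def simplical_face_def fun_eq_iff intro!: arg_cong[of _ _ f])
  moreover have "period (\<lambda>t. f (b (1, t))) = period (edge_path (singular_face 2 0 f))"
    by (rule period_cong) (auto simp: face b_def simplical_face_def fun_eq_iff intro!: arg_cong[of _ _ f])
  moreover have "chain_boundary 2 (frag_of f) = frag_of (singular_face 2 0 f)
      - frag_of (singular_face 2 1 f) + frag_of (singular_face 2 2 f)"
    by (simp add: chain_boundary_of numeral_2_eq_2)
  ultimately show ?thesis
    using sq by (simp add: chain_period_add chain_period_diff chain_period_of)
qed

lemma chain_period_boundary:
  assumes "singular_relboundary 1 (top_of_set M) {} c"
  shows "chain_period c = 0"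
proof -
  obtain e where e: "singular_chain 2 (top_of_set M) e" "c = chain_boundary 2 e"
    using assms unfolding singular_boundary by (auto simp: numeral_2_eq_2)
  have "chain_period (chain_boundary 2 e) = 0"
    using e(1)[unfolded singular_chain_def]
  proof (induction e rule: frag_induction)
    case zero
    show ?case by (simp add: chain_period_0)
  next
    case (one f)
    then show ?case by (simp add: chain_period_simplex_boundary)
  next
    case (diff a b)
    then show ?case by (simp add: chain_boundary_diff chain_period_diff)
  qed
  with e(2) show ?thesis by simp
qed

text \<open>
  Periods factor through homology, so an integral relation between the classes of two loops is
  inherited by their periods.
\<close>
lemma dependent_periods_of_betti_number_lt_2:
  assumes betti: "\<not> 2 \<le> betti_number 1 (top_of_set M)"
    and \<gamma>: "path \<gamma>" "path_image \<gamma> \<subseteq> M" "pathfinish \<gamma> = pathstart \<gamma>"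
    and \<delta>: "path \<delta>" "path_image \<delta> \<subseteq> M" "pathfinish \<delta> = pathstart \<delta>"
  shows "\<exists>n m :: int. (n \<noteq> 0 \<or> m \<noteq> 0) \<and> real_of_int n *\<^sub>R period \<gamma> + real_of_int m *\<^sub>R period \<delta> = 0"
proof -
  obtain n m where nm: "n \<noteq> 0 \<or> m \<noteq> 0" "singular_relboundary 1 (top_of_set M) {}
      (frag_cmul n (frag_of (loop_simplex \<gamma>)) + frag_cmul m (frag_of (loop_simplex \<delta>)))"
    using betti_number_lt_2_imp_relation[OF betti singular_cycle_loop_simplex[OF \<gamma>]
        singular_cycle_loop_simplex[OF \<delta>]] by blast
  have "period (edge_path (loop_simplex \<gamma>)) = period \<gamma>" for \<gamma>
    by (rule period_cong) (rule edge_path_loop_simplex)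
  with chain_period_boundary[OF nm(2)]
  have "real_of_int n *\<^sub>R period \<gamma> + real_of_int m *\<^sub>R period \<delta> = 0"
    by (simp add: chain_period_add chain_period_cmul chain_period_of)
  with nm(1) show ?thesis by blast
qed

text \<open>
  The two edges of the homotopy that are traced out by the base point of the loops agree, so their
  periods cancel in the Stokes theorem for the square.
\<close>
lemma period_homotopic_loops:
  assumes "homotopic_loops M \<gamma> \<delta>"
  shows "period \<gamma> = period \<delta>"
proof -
  obtain h :: "real \<times> real \<Rightarrow> 'a" where
    h: "continuous_on ({0..1} \<times> {0..1}) h" "h ` ({0..1} \<times> {0..1}) \<subseteq> M"
    "\<forall>t\<in>{0..1}. h (0, t) = \<gamma> t" "\<forall>t\<in>{0..1}. h (1, t) = \<delta> t"
    "\<forall>s\<in>{0..1}. h (s, 1) = h (s, 0)"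
    using assms unfolding homotopic_loops
    by (auto simp: pathfinish_def pathstart_def image_subset_iff_funcset)
  have "period (\<lambda>t. h (0, t)) = period \<gamma>" "period (\<lambda>t. h (1, t)) = period \<delta>"
    "period (\<lambda>s. h (s, 1)) = period (\<lambda>s. h (s, 0))"
    by (rule period_cong, simp add: h)+
  with period_square[OF h(1,2)] show ?thesis
    by simp
qed

lemma period_loop_simply_connected:
  assumes "simply_connected M"
    and \<gamma>: "path \<gamma>" "path_image \<gamma> \<subseteq> M" "pathfinish \<gamma> = pathstart \<gamma>"
  shows "period \<gamma> = 0"
proof -
  have p: "\<gamma> 0 \<in> M"
    using \<gamma>(2) by (auto simp: path_image_def)
  have "path (\<lambda>_::real. \<gamma> 0)" "path_image (\<lambda>_::real. \<gamma> 0) \<subseteq> M"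
    "pathfinish (\<lambda>_::real. \<gamma> 0) = pathstart (\<lambda>_::real. \<gamma> 0)"
    using p by (auto simp: path_def path_image_def pathfinish_def pathstart_def)
  with assms have "homotopic_loops M \<gamma> (\<lambda>_. \<gamma> 0)"
    unfolding simply_connected_def by simp
  then show ?thesis
    using period_homotopic_loops period_const[OF p] by simp
qed

lemma increment_self: "p \<in> M \<Longrightarrow> d p p = 0"
  using local_cocycle[of p] by force

text \<open>
  The primitive at \<open>p\<close> is the period of any path to \<open>p\<close> from a base point chosen once for
  each path component; vanishing periods of loops make this independent of the
  path. Near \<open>p\<close> the path can be extended inside the domain of the local primitive \<open>d p\<close>.
\<close>
lemma global_primitive_exists:
  assumes lpc: "locally path_connected M"
    and zero: "\<And>\<gamma>. path \<gamma> \<Longrightarrow> path_image \<gamma> \<subseteq> M \<Longrightarrow> pathfinish \<gamma> = pathstart \<gamma> \<Longrightarrow> period \<gamma> = 0"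
  shows "\<exists>f. primitive_along (\<lambda>p. p) M f"
proof -
  define base where "base p = (SOME q. path_component M p q)" for p
  have base: "path_component M (base p) p" if "p \<in> M" for p
    unfolding base_def using someI[of "path_component M p" p] that
    by (simp add: path_component_refl path_component_sym)
  have base_eq: "base p = base q" if "path_component M p q" for p q
  proof -
    have "path_component M p = path_component M q"
      unfolding path_component_eq_eq using that path_component_mem[OF that] by simp
    then show ?thesis
      by (simp only: base_def)
  qed
  define f where "f p = period (SOME \<gamma>. path \<gamma> \<and> path_image \<gamma> \<subseteq> M \<and> pathstart \<gamma> = base p \<and> pathfinish \<gamma> = p)" for p
  have f_eq: "f p = period \<gamma>"
    if \<gamma>: "path \<gamma>" "path_image \<gamma> \<subseteq> M" "pathstart \<gamma> = base p" "pathfinish \<gamma> = p" for \<gamma> p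
  proof -
    define \<delta> where "\<delta> = (SOME \<gamma>. path \<gamma> \<and> path_image \<gamma> \<subseteq> M \<and> pathstart \<gamma> = base p \<and> pathfinish \<gamma> = p)"
    have \<delta>: "path \<delta> \<and> path_image \<delta> \<subseteq> M \<and> pathstart \<delta> = base p \<and> pathfinish \<delta> = p"
      unfolding \<delta>_def by (rule someI[of _ \<gamma>]) (use \<gamma> in simp)
    then have "period (\<gamma> +++ reversepath \<delta>) = 0"
      using \<gamma> by (intro zero) (auto simp: path_image_join)
    moreover have "period (\<gamma> +++ reversepath \<delta>) = period \<gamma> + period (reversepath \<delta>)"
      using \<gamma> \<delta> by (intro period_joinpaths) auto
    ultimately have "period \<gamma> = period \<delta>"
      using \<delta> by (simp add: period_reversepath)
    then show ?thesis
      by (simp add: f_def \<delta>_def)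
  qed
  have "primitive_along (\<lambda>p. p) M f"
  proof (rule primitive_alongI)
    fix p assume p: "p \<in> M"
    obtain U where U: "open U" "p \<in> U" "\<And>q. q \<in> U \<Longrightarrow> q \<in> M \<Longrightarrow>
        \<exists>V. open V \<and> q \<in> V \<and> (\<forall>r\<in>V \<inter> M. d p r = d p q + d q r)"
      using local_cocycle[OF p] by (elim exE conjE) simp
    have "openin (top_of_set M) (M \<inter> U)"
      using U(1) by auto
    then obtain u v where uv: "openin (top_of_set M) u" "path_connected v" "p \<in> u" "u \<subseteq> v" "v \<subseteq> M \<inter> U"
      using lpc p U(2) unfolding locally_def by (metis IntI)
    obtain W where W: "open W" "u = M \<inter> W"
      using uv(1) by (auto simp: openin_open)
    have "f q = f p + d p q" if q: "q \<in> W \<inter> M" for q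
    proof -
      have "p \<in> v" "q \<in> v"
        using uv q W by auto
      then obtain \<gamma> where \<gamma>: "path \<gamma>" "path_image \<gamma> \<subseteq> v" "pathstart \<gamma> = p" "pathfinish \<gamma> = q"
        using uv(2) unfolding path_connected_def by metis
      have \<gamma>v: "\<gamma> t \<in> v" if "t \<in> {0..1}" for t
        using \<gamma>(2) that by (auto simp: path_image_def)
      have "primitive_along \<gamma> {0..1} (\<lambda>t. d p (\<gamma> t))"
      proof (rule primitive_alongI)
        fix t :: real assume t: "t \<in> {0..1}"
        then obtain V where V: "open V" "\<gamma> t \<in> V" "\<And>r. r \<in> V \<Longrightarrow> r \<in> M \<Longrightarrow> d p r = d p (\<gamma> t) + d (\<gamma> t) r"
          using U(3)[of "\<gamma> t"] \<gamma>v[OF t] uv(5) by (auto simp: subset_iff)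
        obtain B where B: "open B" "\<forall>s\<in>{0..1}. s \<in> B \<longleftrightarrow> \<gamma> s \<in> V"
          using \<gamma>(1)[unfolded path_def] V(1) by (rule preimage_open_within)
        show "\<exists>B. open B \<and> t \<in> B \<and> (\<forall>s\<in>B \<inter> {0..1}. d p (\<gamma> s) = d p (\<gamma> t) + d (\<gamma> t) (\<gamma> s))"
        proof (intro exI conjI ballI)
          fix s assume "s \<in> B \<inter> {0..1}"
          then have "\<gamma> s \<in> V" "\<gamma> s \<in> M"
            using B(2) \<gamma>v[of s] uv(5) by auto
          then show "d p (\<gamma> s) = d p (\<gamma> t) + d (\<gamma> t) (\<gamma> s)"
            by (rule V(3))
        qed (use B t V(2) in auto)
      qed
      then have per: "period \<gamma> = d p q"
        using period_eq \<gamma>(3,4) increment_self[OF p]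
        by (simp add: pathstart_def pathfinish_def)
      have \<gamma>M: "path_image \<gamma> \<subseteq> M"
        using \<gamma>(2) uv(5) by auto
      then have pq: "path_component M p q"
        using \<gamma> unfolding path_component_def by blast
      obtain \<delta> where \<delta>: "path \<delta>" "path_image \<delta> \<subseteq> M" "pathstart \<delta> = base p" "pathfinish \<delta> = p"
        using base[OF p] unfolding path_component_def by blast
      have "f q = period (\<delta> +++ \<gamma>)"
        using \<delta> \<gamma> \<gamma>M base_eq[OF pq] by (intro f_eq) (auto simp: path_image_join)
      also have "\<dots> = period \<delta> + period \<gamma>"
        using \<delta> \<gamma> \<gamma>M by (intro period_joinpaths) auto
      also have "period \<delta> = f p"
        using f_eq[OF \<delta>] by simp
      finally show ?thesis
        using per by simp
    qed
    then show "\<exists>W. open W \<and> p \<in> W \<and> (\<forall>q\<in>W \<inter> M. f q = f p + d p q)"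
      using W uv(3) by blast
  qed
  then show ?thesis by blast
qed

end

section \<open>The Poincare lemma for 1-forms\<close>

text \<open>
  The primitive is the integral of the form over the segment from a fixed point \<open>x0\<close> to \<open>y\<close>.
  Differentiating under the integral in direction \<open>h\<close> and using the symmetry of the derivative turns
  the integrand into the \<open>t\<close>-derivative of \<open>t *\<^sub>R a (x0 + t *\<^sub>R (y - x0)) h\<close>.
\<close>
lemma poincare_lemma_1_forms:
  fixes a :: "'e::euclidean_space \<Rightarrow> 'e \<Rightarrow> 'f::banach"
  assumes B: "open B" "convex B"
    and lin: "\<And>x. x \<in> B \<Longrightarrow> linear (a x)"
    and C1: "\<And>v. C_k_on 1 B (\<lambda>x. a x v)"
    and closed: "\<And>x u v. x \<in> B \<Longrightarrow>
      frechet_derivative (\<lambda>y. a y v) (at x) u = frechet_derivative (\<lambda>y. a y u) (at x) v"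
  shows "\<exists>F. \<forall>y\<in>B. (F has_derivative a y) (at y)"
proof (cases "B = {}")
  case False
  then obtain x0 where x0: "x0 \<in> B" by blast
  define D where "D x v = frechet_derivative (\<lambda>y. a y v) (at x)" for x v
  have D: "((\<lambda>y. a y v) has_derivative D x v) (at x)" if "x \<in> B" for x v
    using C1[of v] that unfolding D_def by (simp add: frechet_derivative_works)
  have contD: "continuous_on B (\<lambda>x. D x v u)" for u v
    using C1[of v] unfolding D_def by simp
  have conta: "continuous_on B (\<lambda>x. a x v)" for v
    by (intro continuous_at_imp_continuous_on ballI has_derivative_continuous[OF D])
  have symD: "D x v u = D x u v" if "x \<in> B" for x u v
    using closed[OF that] unfolding D_def .
  have linD: "linear (D x v)" if "x \<in> B" for x v
    by (rule has_derivative_linear[OF D[OF that]])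
  define \<xi> where "\<xi> y t = x0 + t *\<^sub>R (y - x0)" for y and t :: real
  have \<xi>B: "\<xi> y t \<in> B" if "y \<in> B" "t \<in> {0..1}" for y t
  proof -
    have "\<xi> y t = (1 - t) *\<^sub>R x0 + t *\<^sub>R y"
      by (simp add: \<xi>_def algebra_simps)
    then show ?thesis
      using B(2) x0 that unfolding convex_alt by auto
  qed
  have cont\<xi>: "continuous_on S (\<lambda>z. \<xi> (fst z) (snd z))" for S
    unfolding \<xi>_def by (intro continuous_intros)
  \<comment> \<open>The integrand \<open>a (\<xi> y t) (y - x0)\<close>, expanded in the basis so that no factor depends on \<open>y\<close> in
    two places, and its derivative \<open>L y t\<close> with respect to \<open>y\<close>.\<close>
  define f where "f y t = (\<Sum>b\<in>Basis. ((y - x0) \<bullet> b) *\<^sub>R a (\<xi> y t) b)" for y t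
  define L where "L y t h = a (\<xi> y t) h + t *\<^sub>R (\<Sum>b\<in>Basis. ((y - x0) \<bullet> b) *\<^sub>R D (\<xi> y t) b h)" for y t h
  have L_linear: "linear (L y t)" if "y \<in> B" "t \<in> {0..1}" for y t
    unfolding L_def
    by (intro linear_compose_add linear_compose_scale_right linear_compose_sum ballI lin linD \<xi>B that)
  have L_eq: "L y t h = a (\<xi> y t) h + t *\<^sub>R D (\<xi> y t) h (y - x0)" if "y \<in> B" "t \<in> {0..1}" for y t h
  proof -
    note l = linD[OF \<xi>B[OF that], of h]
    have "D (\<xi> y t) h (y - x0) = D (\<xi> y t) h (\<Sum>b\<in>Basis. ((y - x0) \<bullet> b) *\<^sub>R b)"
      by (simp only: euclidean_representation)
    also have "\<dots> = (\<Sum>b\<in>Basis. ((y - x0) \<bullet> b) *\<^sub>R D (\<xi> y t) h b)"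
      by (simp only: linear_sum[OF l] linear_scale[OF l])
    finally show ?thesis
      unfolding L_def by (simp only: symD[OF \<xi>B[OF that], of h])
  qed
  have f_deriv: "((\<lambda>y. f y t) has_derivative blinfun_apply (Blinfun (L y t))) (at y within B)"
    if yt: "y \<in> B" "t \<in> {0..1}" for y t
  proof -
    note l = lin[OF \<xi>B[OF yt]]
    have \<xi>': "((\<lambda>y. \<xi> y t) has_derivative (\<lambda>h. t *\<^sub>R h)) (at y within B)"
      unfolding \<xi>_def by (auto intro!: derivative_eq_intros)
    have ad: "((\<lambda>y. a (\<xi> y t) b) has_derivative (\<lambda>h. D (\<xi> y t) b (t *\<^sub>R h))) (at y within B)" for b
      by (rule has_derivative_compose[OF \<xi>' D[OF \<xi>B[OF yt]]])
    have "((\<lambda>y. f y t) has_derivative (\<lambda>h. \<Sum>b\<in>Basis. ((y - x0) \<bullet> b) *\<^sub>R D (\<xi> y t) b (t *\<^sub>R h)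
        + (h \<bullet> b) *\<^sub>R a (\<xi> y t) b)) (at y within B)"
      unfolding f_def
      by (intro has_derivative_sum has_derivative_scaleR ad) (auto intro!: derivative_eq_intros)
    moreover have "(\<Sum>b\<in>Basis. ((y - x0) \<bullet> b) *\<^sub>R D (\<xi> y t) b (t *\<^sub>R h) + (h \<bullet> b) *\<^sub>R a (\<xi> y t) b) = L y t h" for h
    proof -
      have "a (\<xi> y t) h = a (\<xi> y t) (\<Sum>b\<in>Basis. (h \<bullet> b) *\<^sub>R b)"
        by (simp only: euclidean_representation)
      also have "\<dots> = (\<Sum>b\<in>Basis. (h \<bullet> b) *\<^sub>R a (\<xi> y t) b)"
        by (simp only: linear_sum[OF l] linear_scale[OF l])
      finally show ?thesis
        unfolding L_def by (simp add: sum.distrib linear_scale[OF linD[OF \<xi>B[OF yt]]] scaleR_sum_right ac_simps)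
    qed
    ultimately show ?thesis
      using L_linear[OF yt] by (simp add: bounded_linear_Blinfun_apply linear_conv_bounded_linear)
  qed
  have L_cont: "continuous_on (B \<times> cbox 0 1) (\<lambda>z. L (fst z) (snd z) h)" for h
  proof -
    have "continuous_on (B \<times> cbox 0 1) (\<lambda>z. a (\<xi> (fst z) (snd z)) h)"
      by (rule continuous_on_compose2[OF conta cont\<xi>]) (use \<xi>B in auto)
    moreover have "continuous_on (B \<times> cbox 0 1) (\<lambda>z. D (\<xi> (fst z) (snd z)) b h)" for b
      by (rule continuous_on_compose2[OF contD cont\<xi>]) (use \<xi>B in auto)
    ultimately show ?thesis
      unfolding L_def by (intro continuous_intros)
  qed
  have BL_cont: "continuous_on (B \<times> cbox 0 1) (\<lambda>(y, t). Blinfun (L y t))"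
  proof (rule continuous_on_blinfun_componentwise)
    fix h :: 'e
    have "blinfun_apply (Blinfun (L (fst z) (snd z))) h = L (fst z) (snd z) h" if "z \<in> B \<times> cbox 0 1" for z
      using L_linear[of "fst z" "snd z"] that
      by (subst bounded_linear_Blinfun_apply) (auto simp: linear_conv_bounded_linear)
    with L_cont[of h]
    show "continuous_on (B \<times> cbox 0 1) (\<lambda>z. blinfun_apply (case z of (y, t) \<Rightarrow> Blinfun (L y t)) h)"
      by (simp add: case_prod_unfold cong: continuous_on_cong)
  qed
  have t_cont: "continuous_on {0..1} (\<lambda>t. \<xi> y t)" for y
    unfolding \<xi>_def by (intro continuous_intros)
  have "((\<lambda>y. integral (cbox 0 1) (f y)) has_derivative a y) (at y)" if y: "y \<in> B" for y
  proof -
    have "f y integrable_on cbox 0 1" if "y \<in> B" for y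
    proof (rule integrable_continuous)
      have "continuous_on (cbox 0 1) (\<lambda>t. a (\<xi> y t) b)" for b
        by (rule continuous_on_compose2[OF conta]) (use \<xi>B that t_cont in auto)
      then show "continuous_on (cbox 0 1) (f y)"
        unfolding f_def by (intro continuous_intros)
    qed
    note int = this
    have "((\<lambda>y. f y t) has_derivative blinfun_apply (Blinfun (L y t))) (at y within B)"
      if "y \<in> B" "t \<in> cbox 0 1" for y t
      using f_deriv that by simp
    from leibniz_rule[where f = f and fx = "\<lambda>y t. Blinfun (L y t)", OF this int BL_cont y B(2)]
    have der: "((\<lambda>y. integral (cbox 0 1) (f y)) has_derivative
        blinfun_apply (integral (cbox 0 1) (\<lambda>t. Blinfun (L y t)))) (at y)"
      by (simp only: at_within_open[OF y B(1)])
    have "blinfun_apply (integral (cbox 0 1) (\<lambda>t. Blinfun (L y t))) h = a y h" for h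
    proof -
      have "continuous_on (cbox 0 1) (\<lambda>t::real. (y, t))"
        by (intro continuous_intros)
      then have "continuous_on (cbox 0 1) (\<lambda>t. Blinfun (L y t))"
        using continuous_on_compose2[OF BL_cont, of "cbox 0 1" "\<lambda>t. (y, t)"] y by auto
      then have int: "(\<lambda>t. Blinfun (L y t)) integrable_on cbox 0 1"
        by (rule integrable_continuous)
      have "blinfun_apply (integral (cbox 0 1) (\<lambda>t. Blinfun (L y t))) h
          = integral (cbox 0 1) (\<lambda>t. blinfun_apply (Blinfun (L y t)) h)"
        using integral_linear[OF int blinfun.bounded_linear_left[of h]] by (simp add: o_def)
      also have "\<dots> = integral {0..1} (\<lambda>t. L y t h)"
        using L_linear[OF y] unfolding cbox_interval
        by (intro integral_cong) (simp add: bounded_linear_Blinfun_apply linear_conv_bounded_linear)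
      also have "\<dots> = 1 *\<^sub>R a (\<xi> y 1) h - 0 *\<^sub>R a (\<xi> y 0) h"
      proof (rule integral_unique, rule fundamental_theorem_of_calculus)
        fix t :: real assume t: "t \<in> {0..1}"
        have "((\<lambda>t. \<xi> y t) has_derivative (\<lambda>s. s *\<^sub>R (y - x0))) (at t within {0..1})"
          unfolding \<xi>_def by (auto intro!: derivative_eq_intros)
        from has_derivative_compose[OF this D[OF \<xi>B[OF y t]]]
        have "((\<lambda>t. a (\<xi> y t) h) has_derivative (\<lambda>s. s *\<^sub>R D (\<xi> y t) h (y - x0))) (at t within {0..1})"
          by (simp add: linear_scale[OF linD[OF \<xi>B[OF y t]]])
        then have "((\<lambda>t. a (\<xi> y t) h) has_vector_derivative D (\<xi> y t) h (y - x0)) (at t within {0..1})"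
          by (simp add: has_vector_derivative_def)
        from has_vector_derivative_scaleR[OF DERIV_ident this]
        show "((\<lambda>t. t *\<^sub>R a (\<xi> y t) h) has_vector_derivative L y t h) (at t within {0..1})"
          by (simp add: L_eq[OF y t] add.commute)
      qed simp
      finally show ?thesis
        by (simp add: \<xi>_def)
    qed
    then have "blinfun_apply (integral (cbox 0 1) (\<lambda>t. Blinfun (L y t))) = a y"
      by (rule ext)
    with der show ?thesis
      by simp
  qed
  then show ?thesis
    by (intro exI ballI)
qed simp

section \<open>Charts and local primitives\<close>

lemma smooth_manifold_chart:
  assumes "smooth_manifold M A" "c \<in> A"
  obtains h where "homeomorphism (fst c) (chart_image c) (snd c) h" "open (chart_image c)"
    "openin (top_of_set M) (fst c)" "fst c \<subseteq> M"
proof -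
  have *: "openin (top_of_set M) (fst c)" "open (chart_image c)"
    "\<exists>h. homeomorphism (fst c) (chart_image c) (snd c) h"
    using assms unfolding smooth_manifold_def by simp_all
  moreover have "fst c \<subseteq> M"
    using openin_subset[OF *(1)] by simp
  ultimately show thesis
    using that by (elim exE)
qed

lemma smooth_manifold_chart_at:
  assumes "smooth_manifold M A" "p \<in> M"
  obtains c where "c \<in> A" "p \<in> fst c"
  using assms unfolding smooth_manifold_def by auto

lemma chart_in_chart_image: "p \<in> fst c \<Longrightarrow> snd c p \<in> chart_image c"
  by (simp add: chart_image_def)

lemma chart_neighbourhood:
  assumes M: "smooth_manifold M A" "c \<in> A" and p: "p \<in> fst c" and B: "open B" "snd c p \<in> B"
  obtains U where "open U" "p \<in> U" "\<forall>q\<in>U \<inter> M. q \<in> fst c \<and> snd c q \<in> B"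
proof -
  obtain h where h: "homeomorphism (fst c) (chart_image c) (snd c) h" "openin (top_of_set M) (fst c)"
    using M by (rule smooth_manifold_chart)
  obtain T where T: "open T" "fst c = M \<inter> T"
    using h(2) by (auto simp: openin_open)
  obtain U where U: "open U" "\<forall>q\<in>fst c. q \<in> U \<longleftrightarrow> snd c q \<in> B"
    using homeomorphism_cont1[OF h(1)] B(1) by (rule preimage_open_within)
  show thesis
  proof (rule that)
    show "open (T \<inter> U)" using T U by auto
    show "p \<in> T \<inter> U" using T(2) U(2) p B(2) by auto
    show "\<forall>q\<in>(T \<inter> U) \<inter> M. q \<in> fst c \<and> snd c q \<in> B" using T(2) U(2) by auto
  qed
qed

lemma coordinate_ball_in_neighbourhood:
  assumes M: "smooth_manifold M A" "c \<in> A" and p: "p \<in> fst c" and U: "open U" "p \<in> U"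
  obtains \<epsilon> where "\<epsilon> > 0" "ball (snd c p) \<epsilon> \<subseteq> snd c ` (fst c \<inter> U)"
proof -
  obtain h where h: "homeomorphism (fst c) (chart_image c) (snd c) h" "open (chart_image c)"
    using M by (rule smooth_manifold_chart)
  obtain T where T: "open T" "\<forall>y\<in>chart_image c. y \<in> T \<longleftrightarrow> h y \<in> U"
    using homeomorphism_cont2[OF h(1)] U(1) by (rule preimage_open_within)
  have "snd c p \<in> T \<inter> chart_image c"
    using T(2) U(2) p chart_in_chart_image[OF p] homeomorphism_apply1[OF h(1)] by auto
  moreover have "open (T \<inter> chart_image c)"
    using T(1) h(2) by auto
  ultimately obtain \<epsilon> where \<epsilon>: "\<epsilon> > 0" "ball (snd c p) \<epsilon> \<subseteq> T \<inter> chart_image c"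
    using open_contains_ball by blast
  have "y \<in> snd c ` (fst c \<inter> U)" if "y \<in> T \<inter> chart_image c" for y
  proof (rule image_eqI)
    show "y = snd c (h y)"
      using homeomorphism_apply2[OF h(1)] that by auto
    show "h y \<in> fst c \<inter> U"
      using that T(2) homeomorphism_image2[OF h(1)] by auto
  qed
  with \<epsilon> show thesis
    by (intro that[of \<epsilon>]) auto
qed

lemma transition_chart:
  assumes M: "smooth_manifold M A" "c \<in> A" and q: "q \<in> fst c"
  shows "transition c c' (snd c q) = snd c' q"
proof -
  obtain h where h: "homeomorphism (fst c) (chart_image c) (snd c) h"
    using M by (rule smooth_manifold_chart)
  have "inj_on (snd c) (fst c)"
    by (rule inj_on_inverseI[of _ h]) (rule homeomorphism_apply1[OF h])
  with q show ?thesis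
    unfolding transition_def o_def by (simp only: inv_into_f_f)
qed

lemma transition_has_derivative:
  assumes M: "smooth_manifold M A" and c: "c \<in> A" "c' \<in> A" and x: "x \<in> overlap c c'"
  shows "(transition c c' has_derivative transition_deriv c c' x) (at x)"
proof -
  have "smooth_on (overlap c c') (transition c c')"
    using M c unfolding smooth_manifold_def by simp
  then have "C_k_on (Suc 0) (overlap c c') (transition c c')"
    unfolding smooth_on_def by (rule spec)
  with x have "transition c c' differentiable (at x)"
    by (simp only: C_k_on.simps)
  then show ?thesis
    by (simp add: frechet_derivative_works)
qed

text \<open>
  Coordinate balls inside a given neighbourhood are open and path connected.
\<close>
lemma locally_path_connected_smooth_manifold:
  assumes M: "smooth_manifold M A"
  shows "locally path_connected M"
proof (rule locallyI)
  fix w x assume w: "openin (top_of_set M) w" "x \<in> w"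
  then obtain U where U: "open U" "w = M \<inter> U"
    by (auto simp: openin_open)
  have "x \<in> M" using w U by auto
  then obtain c where c: "c \<in> A" "x \<in> fst c"
    using smooth_manifold_chart_at[OF M] by metis
  obtain h where h: "homeomorphism (fst c) (chart_image c) (snd c) h"
    "openin (top_of_set M) (fst c)" "fst c \<subseteq> M"
    using M c(1) by (rule smooth_manifold_chart)
  have "x \<in> U" using w U by auto
  obtain \<epsilon> where \<epsilon>: "\<epsilon> > 0" "ball (snd c x) \<epsilon> \<subseteq> snd c ` (fst c \<inter> U)"
    using coordinate_ball_in_neighbourhood[OF M c U(1) \<open>x \<in> U\<close>] by blast
  define v where "v = h ` ball (snd c x) \<epsilon>"
  have img: "ball (snd c x) \<epsilon> \<subseteq> chart_image c"
    using \<epsilon>(2) by (auto simp: chart_image_def)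
  have v_eq: "v = fst c \<inter> snd c -` ball (snd c x) \<epsilon>"
  proof
    show "v \<subseteq> fst c \<inter> snd c -` ball (snd c x) \<epsilon>"
    proof
      fix q assume "q \<in> v"
      then obtain y where y: "y \<in> ball (snd c x) \<epsilon>" "q = h y"
        unfolding v_def by (rule imageE)
      have "y \<in> chart_image c"
        using img y(1) by (rule subsetD)
      then have "h y \<in> fst c" "snd c (h y) = y"
        using homeomorphism_image2[OF h(1)] homeomorphism_apply2[OF h(1)] by auto
      with y show "q \<in> fst c \<inter> snd c -` ball (snd c x) \<epsilon>"
        by simp
    qed
    show "fst c \<inter> snd c -` ball (snd c x) \<epsilon> \<subseteq> v"
    proof
      fix q assume q: "q \<in> fst c \<inter> snd c -` ball (snd c x) \<epsilon>"
      then have "q = h (snd c q)"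
        using homeomorphism_apply1[OF h(1)] by simp
      with q show "q \<in> v"
        unfolding v_def by (intro image_eqI[of q h "snd c q"]) auto
    qed
  qed
  have "openin (top_of_set (fst c)) v"
    unfolding v_eq using homeomorphism_cont1[OF h(1)] by (intro continuous_openin_preimage_gen) auto
  then have 1: "openin (top_of_set M) v"
    using h(2) by (rule openin_trans)
  have 2: "path_connected v"
    unfolding v_def
  proof (rule path_connected_continuous_image)
    show "continuous_on (ball (snd c x) \<epsilon>) h"
      using homeomorphism_cont2[OF h(1)] img by (rule continuous_on_subset)
    show "path_connected (ball (snd c x) \<epsilon>)"
      by (intro convex_imp_path_connected convex_ball)
  qed
  have 3: "x \<in> v"
    unfolding v_eq using c(2) \<epsilon>(1) by simp
  have 4: "v \<subseteq> w"
  proof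
    fix q assume q: "q \<in> v"
    then have "snd c q \<in> snd c ` (fst c \<inter> U)" "q \<in> fst c"
      using \<epsilon>(2) unfolding v_eq by auto
    then obtain r where r: "snd c q = snd c r" "r \<in> fst c" "r \<in> U"
      by auto
    with \<open>q \<in> fst c\<close> have "q = r"
      using homeomorphism_apply1[OF h(1)] by metis
    with r h(3) U(2) show "q \<in> w" by auto
  qed
  show "\<exists>u v. openin (top_of_set M) u \<and> path_connected v \<and> x \<in> u \<and> u \<subseteq> v \<and> v \<subseteq> w"
    using 1 2 3 4 by blast
qed

text \<open>
  A form takes a sequence of vectors; for a 1-form the constant sequence serves as canonical argument.
\<close>
lemma alternating_1_form:
  assumes "alternating_form 1 a"
  shows "linear (\<lambda>u. a (\<lambda>_. u))" and "a v = a (\<lambda>_. v 0)"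
proof -
  note alt = assms[unfolded alternating_form_def]
  have dep: "a v = a w" if "v 0 = w 0" for v w
    using that by (intro alt[THEN conjunct1, rule_format]) simp
  have "linear (\<lambda>u. a ((\<lambda>_. 0)(0 := u)))"
    by (intro alt[THEN conjunct2, THEN conjunct1, rule_format]) simp
  moreover have "a ((\<lambda>_. 0)(0 := u)) = a (\<lambda>_. u)" for u
    by (rule dep) simp
  ultimately show "linear (\<lambda>u. a (\<lambda>_. u))" by (simp only:)
  show "a v = a (\<lambda>_. v 0)"
    by (rule dep) simp
qed

text \<open>
  Evaluating the exterior derivative on a pair of constant vector fields leaves the
  antisymmetrized derivative of the coefficients. Closedness of the real and of the imaginary part
  give the real and the imaginary part of the claim.
\<close>
lemma closed_1_form_symmetric:
  fixes w :: "'e::euclidean_space \<Rightarrow> 'e form"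
  assumes B: "open B" "x \<in> B" and alt: "\<And>y. y \<in> B \<Longrightarrow> alternating_form 1 (w y)"
    and diff: "\<And>v. (\<lambda>y. w y v) differentiable (at x)"
    and Re: "ext_deriv 1 (\<lambda>y. Re_form (w y)) x = (\<lambda>_. 0)"
    and Im: "ext_deriv 1 (\<lambda>y. Im_form (w y)) x = (\<lambda>_. 0)"
  shows "frechet_derivative (\<lambda>y. w y (\<lambda>_. v)) (at x) u = frechet_derivative (\<lambda>y. w y (\<lambda>_. u)) (at x) v"
proof -
  define D where "D v = frechet_derivative (\<lambda>y. w y v) (at x)" for v
  have D: "((\<lambda>y. w y v) has_derivative D v) (at x)" for v
    using diff unfolding D_def by (simp add: frechet_derivative_works)
  have Dcong: "D v = D (\<lambda>_. v 0)" for v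
  proof -
    have "((\<lambda>y. w y (\<lambda>_. v 0)) has_derivative D v) (at x)"
      by (rule has_derivative_transform_within_open[OF D B]) (rule alternating_1_form(2)[OF alt])
    from has_derivative_unique[OF this D] show ?thesis .
  qed
  have DRe: "frechet_derivative (\<lambda>y. Re_form (w y) v) (at x) = (\<lambda>h. of_real (Re (D v h)))" for v
    unfolding Re_form_def
    by (rule frechet_derivative_at[symmetric]) (intro has_derivative_of_real has_derivative_Re D)
  have DIm: "frechet_derivative (\<lambda>y. Im_form (w y) v) (at x) = (\<lambda>h. of_real (Im (D v h)))" for v
    unfolding Im_form_def
    by (rule frechet_derivative_at[symmetric]) (intro has_derivative_of_real has_derivative_Im D)
  \<comment> \<open>The pair of arguments on which the vanishing exterior derivatives are evaluated.\<close>
  define p where "p i = (if i = 0 then u else v)" for i :: nat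
  have p: "p 0 = u" "p (Suc 0) = v" "D (\<lambda>j. p (Suc j)) = D (\<lambda>_. v)"
    "D (\<lambda>j. if j = 0 then p j else p (Suc j)) = D (\<lambda>_. u)"
    using Dcong[of "\<lambda>j. if j = 0 then p j else p (Suc j)"] by (simp_all add: p_def)
  have "Re (D (\<lambda>_. v) u) = Re (D (\<lambda>_. u) v)"
    using fun_cong[OF Re, of p] unfolding ext_deriv_def DRe
    by (simp add: p flip: of_real_diff)
  moreover have "Im (D (\<lambda>_. v) u) = Im (D (\<lambda>_. u) v)"
    using fun_cong[OF Im, of p] unfolding ext_deriv_def DIm
    by (simp add: p flip: of_real_diff)
  ultimately show ?thesis
    unfolding D_def by (rule complex_eqI)
qed

lemma local_primitive_exists:
  fixes A :: "('a::{t2_space, second_countable_topology}, 'e::euclidean_space) chart set"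
  assumes M: "smooth_manifold M A" and w: "differential_form A 1 w"
    and closed: "\<And>c x. c \<in> A \<Longrightarrow> x \<in> chart_image c \<Longrightarrow>
      ext_deriv 1 (\<lambda>y. Re_form (w c y)) x = (\<lambda>_. 0) \<and> ext_deriv 1 (\<lambda>y. Im_form (w c y)) x = (\<lambda>_. 0)"
    and p: "p \<in> M"
  obtains c B F where "c \<in> A" "p \<in> fst c" "open B" "snd c p \<in> B" "B \<subseteq> chart_image c"
    "\<forall>y\<in>B. (F has_derivative (\<lambda>v. w c y (\<lambda>_. v))) (at y)"
proof -
  obtain c where c: "c \<in> A" "p \<in> fst c"
    using M p by (rule smooth_manifold_chart_at)
  obtain h where h: "homeomorphism (fst c) (chart_image c) (snd c) h" "open (chart_image c)"
    using M c(1) by (rule smooth_manifold_chart)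
  obtain \<epsilon> where \<epsilon>: "\<epsilon> > 0" "ball (snd c p) \<epsilon> \<subseteq> chart_image c"
    using h(2) chart_in_chart_image[OF c(2)] open_contains_ball by blast
  let ?B = "ball (snd c p) \<epsilon>"
  note wc = bspec[OF w[unfolded differential_form_def, THEN conjunct1] c(1)]
  have alt: "alternating_form 1 (w c y)" if "y \<in> chart_image c" for y
    using wc[THEN conjunct1] that by (rule bspec)
  have C1: "C_k_on 1 (chart_image c) (\<lambda>y. w c y v)" for v
    using wc[THEN conjunct2, THEN spec, of v] unfolding smooth_on_def by (rule spec)
  have "\<exists>F. \<forall>y\<in>?B. (F has_derivative (\<lambda>v. w c y (\<lambda>_. v))) (at y)"
  proof (rule poincare_lemma_1_forms)
    show "linear (\<lambda>v. w c y (\<lambda>_. v))" if "y \<in> ?B" for y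
      using alternating_1_form(1)[OF alt] \<epsilon>(2) that by blast
    show "C_k_on 1 ?B (\<lambda>y. w c y (\<lambda>_. v))" for v
      using C1[of "\<lambda>_. v"] \<epsilon>(2) by (auto intro: continuous_on_subset)
    show "frechet_derivative (\<lambda>y. w c y (\<lambda>_. v)) (at y) u = frechet_derivative (\<lambda>y. w c y (\<lambda>_. u)) (at y) v"
      if "y \<in> ?B" for y u v
    proof (rule closed_1_form_symmetric[OF h(2) _ alt])
      show y: "y \<in> chart_image c" using that \<epsilon>(2) by auto
      show "(\<lambda>y. w c y v) differentiable (at y)" for v using C1[of v] y by simp
    qed (use closed[OF c(1)] that \<epsilon>(2) in auto)
  qed auto
  then obtain F where "\<forall>y\<in>?B. (F has_derivative (\<lambda>v. w c y (\<lambda>_. v))) (at y)"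
    by (elim exE)
  with c \<epsilon> show thesis
    by (intro that[of c ?B F]) auto
qed

text \<open>
  Near \<open>q\<close> the function \<open>F' \<circ> transition c c' - F\<close> has derivative 0, since both local
  representatives of \<open>w\<close> correspond under the transition map.
\<close>
lemma local_primitives_differ_by_constant:
  fixes A :: "('a::{t2_space, second_countable_topology}, 'e::euclidean_space) chart set"
  assumes M: "smooth_manifold M A" and w: "differential_form A 1 w"
    and c: "c \<in> A" "open B" "B \<subseteq> chart_image c" "\<forall>y\<in>B. (F has_derivative (\<lambda>v. w c y (\<lambda>_. v))) (at y)"
    and c': "c' \<in> A" "open B'" "B' \<subseteq> chart_image c'" "\<forall>y\<in>B'. (F' has_derivative (\<lambda>v. w c' y (\<lambda>_. v))) (at y)"
    and q: "q \<in> fst c" "snd c q \<in> B" "q \<in> fst c'" "snd c' q \<in> B'"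
  obtains V where "open V" "q \<in> V"
    "\<forall>r\<in>V \<inter> M. F' (snd c' r) - F' (snd c' q) = F (snd c r) - F (snd c q)"
proof -
  obtain U' where U': "open U'" "q \<in> U'" "\<forall>r\<in>U' \<inter> M. r \<in> fst c' \<and> snd c' r \<in> B'"
    using chart_neighbourhood[OF M c'(1) q(3) c'(2) q(4)] by metis
  obtain U where U: "open U" "q \<in> U" "\<forall>r\<in>U \<inter> M. r \<in> fst c \<and> snd c r \<in> B"
    using chart_neighbourhood[OF M c(1) q(1) c(2) q(2)] by metis
  obtain h where h: "fst c \<subseteq> M"
    using M c(1) by (rule smooth_manifold_chart)
  have "open (U \<inter> U')" "q \<in> U \<inter> U'" using U U' by auto
  then obtain \<epsilon> where \<epsilon>: "\<epsilon> > 0" "ball (snd c q) \<epsilon> \<subseteq> snd c ` (fst c \<inter> (U \<inter> U'))"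
    using coordinate_ball_in_neighbourhood[OF M c(1) q(1)] by metis
  let ?T = "transition c c'"
  have "\<exists>k. \<forall>y\<in>ball (snd c q) \<epsilon>. F' (?T y) - F y = k"
  proof (rule has_derivative_zero_constant)
    fix y assume "y \<in> ball (snd c q) \<epsilon>"
    then obtain r where r: "y = snd c r" "r \<in> fst c" "r \<in> U" "r \<in> U'"
      using \<epsilon>(2) by auto
    have "r \<in> M" using h r(2) by (rule subsetD)
    then have r': "snd c r \<in> B" "r \<in> fst c'" "snd c' r \<in> B'"
      using bspec[OF U(3), of r] bspec[OF U'(3), of r] r(3,4) by simp_all
    have y: "y \<in> overlap c c'" "?T y = snd c' r"
      unfolding overlap_def r(1) using r(2) r'(2) by (auto intro: transition_chart[OF M c(1)])
    have "y \<in> B" "?T y \<in> B'"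
      using r(1) r' y(2) by simp_all
    have "(F' has_derivative (\<lambda>v. w c' (?T y) (\<lambda>_. v))) (at (?T y))"
      using c'(4) \<open>?T y \<in> B'\<close> by (rule bspec)
    from has_derivative_compose[OF transition_has_derivative[OF M c(1) c'(1) y(1)] this]
    have "((\<lambda>y. F' (?T y)) has_derivative (\<lambda>v. w c' (?T y) (\<lambda>_. transition_deriv c c' y v))) (at y)" .
    moreover have "(\<lambda>v. w c' (?T y) (\<lambda>_. transition_deriv c c' y v)) = (\<lambda>v. w c y (\<lambda>_. v))"
      by (rule ext) (rule w[unfolded differential_form_def, THEN conjunct2, rule_format, OF c(1) c'(1) y(1), symmetric])
    ultimately have "((\<lambda>y. F' (?T y)) has_derivative (\<lambda>v. w c y (\<lambda>_. v))) (at y)"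
      by (simp only:)
    moreover have "(F has_derivative (\<lambda>v. w c y (\<lambda>_. v))) (at y)"
      using c(4) \<open>y \<in> B\<close> by (rule bspec)
    ultimately have "((\<lambda>y. F' (?T y) - F y) has_derivative (\<lambda>v. w c y (\<lambda>_. v) - w c y (\<lambda>_. v))) (at y)"
      by (rule has_derivative_diff)
    then have "((\<lambda>y. F' (?T y) - F y) has_derivative (\<lambda>h. 0)) (at y)"
      by (simp only: diff_self)
    then show "((\<lambda>y. F' (?T y) - F y) has_derivative (\<lambda>h. 0)) (at y within ball (snd c q) \<epsilon>)"
      by (rule has_derivative_at_withinI)
  qed simp
  then obtain k where k: "\<forall>y\<in>ball (snd c q) \<epsilon>. F' (?T y) - F y = k"
    by (elim exE)
  obtain V where V: "open V" "q \<in> V" "\<forall>r\<in>V \<inter> M. r \<in> fst c \<and> snd c r \<in> ball (snd c q) \<epsilon>"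
    using chart_neighbourhood[OF M c(1) q(1) open_ball] \<epsilon>(1) by (metis centre_in_ball)
  have eq: "F' (snd c' r) - F (snd c r) = k" if "r \<in> V \<inter> M" for r
    using bspec[OF k, of "snd c r"] V(3) that transition_chart[OF M c(1), of r c'] by simp
  have "q \<in> V \<inter> M" using V q(1) h by auto
  have "F' (snd c' r) - F' (snd c' q) = F (snd c r) - F (snd c q)" if "r \<in> V \<inter> M" for r
    using eq[OF that] eq[OF \<open>q \<in> V \<inter> M\<close>] by (simp add: diff_eq_eq add_diff_eq diff_add_eq)
  with V(1,2) show thesis
    by (intro that[of V] ballI)
qed

section \<open>Closed 1-forms on compact manifolds\<close>

text \<open>
  The second property records which increment is meant. It is what connects a primitive of \<open>d\<close> to
  the values of \<open>w\<close> in a chart.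
\<close>
lemma increment_of_closed_1_form:
  fixes A :: "('a::{t2_space, second_countable_topology}, 'e::euclidean_space) chart set"
  assumes M: "smooth_manifold M A" and w: "differential_form A 1 w"
    and closed: "\<And>c x. c \<in> A \<Longrightarrow> x \<in> chart_image c \<Longrightarrow>
      ext_deriv 1 (\<lambda>y. Re_form (w c y)) x = (\<lambda>_. 0) \<and> ext_deriv 1 (\<lambda>y. Im_form (w c y)) x = (\<lambda>_. 0)"
  obtains d where "increment_cocycle M d"
    "\<forall>p\<in>M. \<exists>c B F. c \<in> A \<and> p \<in> fst c \<and> open B \<and> snd c p \<in> B \<and> B \<subseteq> chart_image c \<and>
       (\<forall>y\<in>B. (F has_derivative (\<lambda>v. w c y (\<lambda>_. v))) (at y)) \<and> d p = (\<lambda>q. F (snd c q) - F (snd c p))"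
proof -
  define P where "P p x \<longleftrightarrow> (case x of (c, B, F) \<Rightarrow> c \<in> A \<and> p \<in> fst c \<and> open B \<and> snd c p \<in> B \<and>
      B \<subseteq> chart_image c \<and> (\<forall>y\<in>B. (F has_derivative (\<lambda>v. w c y (\<lambda>_. v))) (at y)))" for p x
  have "\<forall>p\<in>M. \<exists>x. P p x"
  proof
    fix p assume "p \<in> M"
    then obtain c B F where "c \<in> A" "p \<in> fst c" "open B" "snd c p \<in> B" "B \<subseteq> chart_image c"
      "\<forall>y\<in>B. (F has_derivative (\<lambda>v. w c y (\<lambda>_. v))) (at y)"
      using local_primitive_exists[OF M w closed] by metis
    then have "P p (c, B, F)"
      unfolding P_def prod.case by (intro conjI)
    then show "\<exists>x. P p x" by (rule exI)
  qed
  then obtain x where x: "\<forall>p\<in>M. P p (x p)"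
    by (rule bchoice[THEN exE])
  define c B F where "c p = fst (x p)" and "B p = fst (snd (x p))" and "F p = snd (snd (x p))" for p
  have P: "c p \<in> A" "p \<in> fst (c p)" "open (B p)" "snd (c p) p \<in> B p" "B p \<subseteq> chart_image (c p)"
    "\<forall>y\<in>B p. (F p has_derivative (\<lambda>v. w (c p) y (\<lambda>_. v))) (at y)" if "p \<in> M" for p
    using bspec[OF x that] unfolding P_def c_def B_def F_def case_prod_beta by simp_all
  define d where "d p q = F p (snd (c p) q) - F p (snd (c p) p)" for p q
  have "increment_cocycle M d"
  proof
    fix p assume p: "p \<in> M"
    obtain U where U: "open U" "p \<in> U" "\<forall>q\<in>U \<inter> M. q \<in> fst (c p) \<and> snd (c p) q \<in> B p"
      using chart_neighbourhood[OF M P(1-4)[OF p]] by metis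
    have "\<exists>V. open V \<and> q \<in> V \<and> (\<forall>r\<in>V \<inter> M. d p r = d p q + d q r)" if q: "q \<in> U \<inter> M" for q
    proof -
      have qM: "q \<in> M" and qp: "q \<in> fst (c p)" "snd (c p) q \<in> B p"
        using bspec[OF U(3) q] q by simp_all
      obtain V where V: "open V" "q \<in> V"
        "\<forall>r\<in>V \<inter> M. F p (snd (c p) r) - F p (snd (c p) q) = F q (snd (c q) r) - F q (snd (c q) q)"
        using local_primitives_differ_by_constant[OF M w P(1,3,5,6)[OF qM] P(1,3,5,6)[OF p] P(2,4)[OF qM] qp]
        by metis
      have "d p r = d p q + d q r" if "r \<in> V \<inter> M" for r
        using bspec[OF V(3) that] unfolding d_def by (simp add: algebra_simps)
      with V(1,2) show ?thesis by (intro exI conjI ballI)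
    qed
    then have "\<forall>q\<in>U \<inter> M. \<exists>V. open V \<and> q \<in> V \<and> (\<forall>r\<in>V \<inter> M. d p r = d p q + d q r)"
      by (rule ballI)
    with U(1,2) show "\<exists>U. open U \<and> p \<in> U \<and> (\<forall>q\<in>U \<inter> M. \<exists>V. open V \<and> q \<in> V \<and> (\<forall>r\<in>V \<inter> M. d p r = d p q + d q r))"
      by (intro exI[of _ U] conjI)
  qed
  moreover have "\<exists>c B F. c \<in> A \<and> p \<in> fst c \<and> open B \<and> snd c p \<in> B \<and> B \<subseteq> chart_image c \<and>
       (\<forall>y\<in>B. (F has_derivative (\<lambda>v. w c y (\<lambda>_. v))) (at y)) \<and> d p = (\<lambda>q. F (snd c q) - F (snd c p))"
    if p: "p \<in> M" for p
    by (intro exI[of _ "c p"] exI[of _ "B p"] exI[of _ "F p"] conjI P[OF p]) (simp add: d_def fun_eq_iff)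
  ultimately show thesis
    by (intro that[of d] ballI)
qed

text \<open>
  The hypothesis on \<open>f\<close> says that \<open>f\<close> is a global primitive of \<open>L\<close> applied to \<open>w\<close>; the point is one
  where \<open>f\<close> attains its maximum.
\<close>
lemma exact_1_form_vanishes_somewhere:
  fixes A :: "('a::{t2_space, second_countable_topology}, 'e::euclidean_space) chart set"
    and f :: "'a \<Rightarrow> real"
  assumes M: "smooth_manifold M A" "compact M"
    and d: "\<forall>p\<in>M. \<exists>c B F. c \<in> A \<and> p \<in> fst c \<and> open B \<and> snd c p \<in> B \<and> B \<subseteq> chart_image c \<and>
       (\<forall>y\<in>B. (F has_derivative (\<lambda>v. w c y (\<lambda>_. v))) (at y)) \<and> d p = (\<lambda>q. F (snd c q) - F (snd c p))"
    and L: "bounded_linear L"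
    and f: "\<forall>p\<in>M. \<exists>W. open W \<and> p \<in> W \<and> (\<forall>q\<in>W \<inter> M. f q = f p + L (d p q))"
  obtains c p where "c \<in> A" "p \<in> fst c" "\<forall>v. L (w c (snd c p) (\<lambda>_. v)) = 0"
proof -
  have "continuous (at p within M) f" if p: "p \<in> M" for p
  proof -
    obtain c B F where c: "c \<in> A" "p \<in> fst c" "open B" "snd c p \<in> B" "B \<subseteq> chart_image c"
      "\<forall>y\<in>B. (F has_derivative (\<lambda>v. w c y (\<lambda>_. v))) (at y)" "d p = (\<lambda>q. F (snd c q) - F (snd c p))"
      using bspec[OF d p] by (elim exE conjE)
    obtain W where W: "open W" "p \<in> W" "\<forall>q\<in>W \<inter> M. f q = f p + L (d p q)"
      using bspec[OF f p] by (elim exE conjE)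
    obtain U where U: "open U" "p \<in> U" "\<forall>q\<in>U \<inter> M. q \<in> fst c \<and> snd c q \<in> B"
      using chart_neighbourhood[OF M(1) c(1-4)] by metis
    obtain h where h: "homeomorphism (fst c) (chart_image c) (snd c) h"
      using M(1) c(1) by (rule smooth_manifold_chart)
    define N where "N = W \<inter> U"
    have N: "open N" "p \<in> N" "\<And>q. q \<in> M \<inter> N \<Longrightarrow> q \<in> fst c \<and> snd c q \<in> B"
      using W U by (auto simp: N_def)
    have "continuous_on B F"
      using c(6) by (intro continuous_at_imp_continuous_on ballI has_derivative_continuous) (rule bspec)
    moreover have "continuous_on (M \<inter> N) (snd c)"
      using homeomorphism_cont1[OF h] by (rule continuous_on_subset) (use N(3) in auto)
    ultimately have "continuous_on (M \<inter> N) (\<lambda>q. F (snd c q))"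
      by (rule continuous_on_compose2) (use N(3) in auto)
    then have "continuous_on (M \<inter> N) (\<lambda>q. f p + L (F (snd c q) - F (snd c p)))"
      by (intro continuous_intros bounded_linear.continuous_on[OF L])
    moreover have "f q = f p + L (F (snd c q) - F (snd c p))" if "q \<in> M \<inter> N" for q
      using bspec[OF W(3), of q] that unfolding c(7) N_def by simp
    ultimately have "continuous_on (M \<inter> N) f"
      by (subst continuous_on_cong[OF refl]) assumption+
    then have "continuous (at p within (M \<inter> N)) f"
      using p N(2) by (simp add: continuous_on_eq_continuous_within)
    moreover have "at p within (M \<inter> N) = at p within M"
      using N(2,1) by (rule at_within_nhd) auto
    ultimately show ?thesis by (simp only:)
  qed
  then have "continuous_on M f"
    by (simp add: continuous_on_eq_continuous_within)
  moreover have "M \<noteq> {}"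
    using M(1) by (simp add: smooth_manifold_def)
  ultimately obtain p where p: "p \<in> M" "\<forall>q\<in>M. f q \<le> f p"
    using continuous_attains_sup[OF M(2)] by metis
  obtain c B F where c: "c \<in> A" "p \<in> fst c" "open B" "snd c p \<in> B" "B \<subseteq> chart_image c"
    "\<forall>y\<in>B. (F has_derivative (\<lambda>v. w c y (\<lambda>_. v))) (at y)" "d p = (\<lambda>q. F (snd c q) - F (snd c p))"
    using bspec[OF d p(1)] by (elim exE conjE)
  obtain W where W: "open W" "p \<in> W" "\<forall>q\<in>W \<inter> M. f q = f p + L (d p q)"
    using bspec[OF f p(1)] by (elim exE conjE)
  obtain \<epsilon> where \<epsilon>: "\<epsilon> > 0" "ball (snd c p) \<epsilon> \<subseteq> snd c ` (fst c \<inter> W)"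
    using coordinate_ball_in_neighbourhood[OF M(1) c(1,2) W(1,2)] by metis
  obtain h where h: "fst c \<subseteq> M"
    using M(1) c(1) by (rule smooth_manifold_chart)
  have "L (F y) \<le> L (F (snd c p))" if y: "y \<in> ball (snd c p) \<epsilon>" for y
  proof -
    obtain r where r: "y = snd c r" "r \<in> fst c" "r \<in> W"
      using subsetD[OF \<epsilon>(2) y] by blast
    then have "r \<in> M" using h by auto
    have "f r = f p + L (d p r)"
      using \<open>r \<in> M\<close> r(3) by (intro bspec[OF W(3)]) simp
    moreover have "f r \<le> f p"
      using p(2) \<open>r \<in> M\<close> by (rule bspec)
    ultimately show ?thesis
      unfolding c(7) r(1) by (simp add: linear_diff[OF bounded_linear.linear[OF L]])
  qed
  moreover have "((\<lambda>y. L (F y)) has_derivative (\<lambda>v. L (w c (snd c p) (\<lambda>_. v)))) (at (snd c p))"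
    by (rule bounded_linear.has_derivative[OF L bspec[OF c(6,4)]])
  ultimately have "(\<lambda>v. L (w c (snd c p) (\<lambda>_. v))) = (\<lambda>v. 0)"
    using \<epsilon>(1) by (intro differential_zero_maxmin[of "snd c p" "ball (snd c p) \<epsilon>"]) auto
  then have "\<forall>v. L (w c (snd c p) (\<lambda>_. v)) = 0"
    by (simp add: fun_eq_iff)
  with c(1,2) show thesis
    by (rule that)
qed

section \<open>Periods of solutions of the SUSY equations\<close>

text \<open>
  A nonzero element \<open>x\<close> determines the line, and \<open>\<i> * x\<close> is a normal vector to it. In a relation
  between \<open>x\<close> and \<open>y\<close> the coefficient of \<open>y\<close> cannot vanish, so \<open>y\<close> is a real multiple of \<open>x\<close>.
\<close>
lemma pairwise_dependent_complex_on_line: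
  assumes dep: "\<And>x y. x \<in> S \<Longrightarrow> y \<in> S \<Longrightarrow>
    \<exists>n m :: int. (n \<noteq> 0 \<or> m \<noteq> 0) \<and> real_of_int n *\<^sub>R x + real_of_int m *\<^sub>R y = (0::complex)"
  shows "\<exists>z. z \<noteq> 0 \<and> (\<forall>x\<in>S. Re (cnj z * x) = 0)"
proof (cases "S \<subseteq> {0}")
  case True
  then show ?thesis
    by (intro exI[of _ 1]) auto
next
  case False
  then obtain x where x: "x \<in> S" "x \<noteq> 0" by auto
  have "Re (cnj (\<i> * x) * y) = 0" if y: "y \<in> S" for y
  proof -
    obtain n m :: int where nm: "n \<noteq> 0 \<or> m \<noteq> 0" "real_of_int n *\<^sub>R x + real_of_int m *\<^sub>R y = 0"
      using dep[OF x(1) y] by blast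
    then have m: "m \<noteq> 0" using x(2) by auto
    have "real_of_int m * Re (cnj (\<i> * x) * y) = Re (cnj (\<i> * x) * (real_of_int m *\<^sub>R y))"
      by (simp add: algebra_simps)
    also have "real_of_int m *\<^sub>R y = - real_of_int n *\<^sub>R x"
      using nm(2) by (simp add: eq_neg_iff_add_eq_0 add.commute)
    also have "Re (cnj (\<i> * x) * (- real_of_int n *\<^sub>R x)) = 0"
      by (simp add: algebra_simps)
    finally show ?thesis using m by simp
  qed
  with x(2) show ?thesis
    by (intro exI[of _ "\<i> * x"]) auto
qed

text \<open>
  By complex linearity \<open>\<alpha> (J u) = \<i> * \<alpha> u\<close>, so if the real part of \<open>cnj z * \<alpha>\<close> vanishes identically, its
  imaginary part does too. The norm condition excludes \<open>\<alpha> = 0\<close>.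
\<close>
lemma SU2_at_real_part_nonzero:
  assumes SU2: "SU2_at J g \<alpha> \<omega> \<Omega>" and alt: "alternating_form 1 \<alpha>" and z: "z \<noteq> 0"
  shows "\<exists>v. Re (cnj z * \<alpha> (\<lambda>_. v)) \<noteq> 0"
proof (rule ccontr)
  assume "\<nexists>v. Re (cnj z * \<alpha> (\<lambda>_. v)) \<noteq> 0"
  then have Re0: "Re (cnj z * \<alpha> (\<lambda>_. v)) = 0" for v
    by blast
  have J: "type_k0 1 J \<alpha>" and norm: "contract g (cnj_form \<alpha>) \<alpha> = (\<lambda>_. 2)"
    using SU2 unfolding SU2_at_def by blast+
  have "\<alpha> (\<lambda>_. u) = 0" for u
  proof -
    have "\<alpha> ((\<lambda>_. u)(0 := J u)) = \<i> * \<alpha> (\<lambda>_. u)"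
      using J[unfolded type_k0_def, THEN spec, of "\<lambda>_. u"] by simp
    moreover have "\<alpha> ((\<lambda>_. u)(0 := J u)) = \<alpha> (\<lambda>_. J u)"
      using alternating_1_form(2)[OF alt, of "(\<lambda>_. u)(0 := J u)"] by simp
    ultimately have "Re (cnj z * (\<i> * \<alpha> (\<lambda>_. u))) = 0"
      using Re0[of "J u"] by simp
    then have "Im (cnj z * \<alpha> (\<lambda>_. u)) = 0"
      by (simp add: algebra_simps)
    with Re0[of u] have "cnj z * \<alpha> (\<lambda>_. u) = 0"
      by (intro complex_eqI) simp_all
    with z show ?thesis by simp
  qed
  then have "\<alpha> v = 0" for v
    using alternating_1_form(2)[OF alt, of v] by simp
  then have "contract g (cnj_form \<alpha>) \<alpha> = (\<lambda>_. 0)"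
    by (simp add: contract_def)
  with norm show False
    by (simp add: fun_eq_iff)
qed

text \<open>
  If \<open>Re (cnj z * period \<gamma>)\<close> vanished for all loops, \<open>Re (cnj z * \<alpha>)\<close> would be exact and hence
  vanish somewhere.
\<close>
lemma SUSY_IIB_periods_span_plane:
  fixes A :: "('a::{t2_space, second_countable_topology}, 'e::euclidean_space) chart set"
  assumes M: "smooth_manifold M A" "compact M"
    and SU2: "SU2_structure A J g \<alpha> \<omega> \<Omega>" and SUSY: "SUSY_IIB A kpar kperp \<alpha> \<omega> \<Omega>"
  obtains d :: "'a \<Rightarrow> 'a \<Rightarrow> complex" where "increment_cocycle M d"
    "\<forall>z. z \<noteq> 0 \<longrightarrow> (\<exists>\<gamma>. path \<gamma> \<and> path_image \<gamma> \<subseteq> M \<and> pathfinish \<gamma> = pathstart \<gamma> \<and>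
       Re (cnj z * increment_cocycle.period d \<gamma>) \<noteq> 0)"
proof -
  have \<alpha>: "differential_form A 1 \<alpha>"
    using SU2 unfolding SU2_structure_def by (elim conjE)
  have closed: "ext_deriv 1 (\<lambda>y. Re_form (\<alpha> c y)) x = (\<lambda>_. 0) \<and> ext_deriv 1 (\<lambda>y. Im_form (\<alpha> c y)) x = (\<lambda>_. 0)"
    if "c \<in> A" "x \<in> chart_image c" for c x
  proof -
    obtain \<phi> H where "\<forall>c\<in>A. \<forall>x\<in>chart_image c. SUSY_IIB_at kpar kperp \<phi> (\<alpha> c) (\<omega> c) (\<Omega> c) (H c) x"
      using SUSY unfolding SUSY_IIB_def by (elim exE conjE)
    from bspec[OF bspec[OF this that(1)] that(2)] show ?thesis
      unfolding SUSY_IIB_at_def Let_def by (elim conjE, intro conjI)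
  qed
  obtain d where d: "increment_cocycle M d"
    "\<forall>p\<in>M. \<exists>c B F. c \<in> A \<and> p \<in> fst c \<and> open B \<and> snd c p \<in> B \<and> B \<subseteq> chart_image c \<and>
       (\<forall>y\<in>B. (F has_derivative (\<lambda>v. \<alpha> c y (\<lambda>_. v))) (at y)) \<and> d p = (\<lambda>q. F (snd c q) - F (snd c p))"
    by (rule increment_of_closed_1_form[OF M(1) \<alpha> closed])
  interpret increment_cocycle M d
    by (rule d(1))
  have "\<exists>\<gamma>. path \<gamma> \<and> path_image \<gamma> \<subseteq> M \<and> pathfinish \<gamma> = pathstart \<gamma> \<and> Re (cnj z * period \<gamma>) \<noteq> 0"
    if z: "z \<noteq> 0" for z
  proof (rule ccontr)
    assume *: "\<nexists>\<gamma>. path \<gamma> \<and> path_image \<gamma> \<subseteq> M \<and> pathfinish \<gamma> = pathstart \<gamma> \<and> Re (cnj z * period \<gamma>) \<noteq> 0"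
    define L where "L x = Re (cnj z * x)" for x
    have L: "bounded_linear L"
      unfolding L_def by (rule bounded_linear_compose[OF bounded_linear_Re bounded_linear_mult_right])
    interpret L: increment_cocycle M "\<lambda>p q. L (d p q)"
      by (rule increment_cocycle_linear[OF bounded_linear.linear[OF L]])
    have "L.period \<gamma> = 0" if "path \<gamma>" "path_image \<gamma> \<subseteq> M" "pathfinish \<gamma> = pathstart \<gamma>" for \<gamma>
      using * that period_linear[OF bounded_linear.linear[OF L] that(1,2)] by (auto simp: L_def)
    then obtain f where f: "L.primitive_along (\<lambda>p. p) M f"
      using L.global_primitive_exists[OF locally_path_connected_smooth_manifold[OF M(1)]] by blast
    obtain c p where cp: "c \<in> A" "p \<in> fst c" "\<forall>v. L (\<alpha> c (snd c p) (\<lambda>_. v)) = 0"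
      by (rule exact_1_form_vanishes_somewhere[OF M d(2) L f[unfolded L.primitive_along_def]])
    have x: "snd c p \<in> chart_image c"
      by (rule chart_in_chart_image[OF cp(2)])
    have "SU2_at (J c (snd c p)) (g c (snd c p)) (\<alpha> c (snd c p)) (\<omega> c (snd c p)) (\<Omega> c (snd c p))"
      by (rule SU2[unfolded SU2_structure_def, THEN conjunct2, THEN conjunct2, THEN conjunct2,
            THEN conjunct2, rule_format, OF cp(1) x])
    moreover have "alternating_form 1 (\<alpha> c (snd c p))"
      by (rule \<alpha>[unfolded differential_form_def, THEN conjunct1, rule_format, OF cp(1),
            THEN conjunct1, rule_format, OF x])
    ultimately obtain v where "L (\<alpha> c (snd c p) (\<lambda>_. v)) \<noteq> 0"
      using SU2_at_real_part_nonzero z unfolding L_def by metis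
    with cp(3) show False by simp
  qed
  with d(1) show thesis
    by (intro that[of d] allI impI)
qed

theorem proposition3p7:
  fixes M :: "'a::{t2_space, second_countable_topology} set"
    and A :: "('a, real^6) chart set"
    and kpar kperp :: real
  assumes "kpar \<in> {0<..<1}" and "kperp \<in> {0<..<1}" and "kpar\<^sup>2 + kperp\<^sup>2 = 1"
    and "smooth_manifold M A" and "compact M"
  shows "(\<forall>J g \<alpha> \<omega> \<Omega>. SU2_structure A J g \<alpha> \<omega> \<Omega> \<and> SUSY_IIB A kpar kperp \<alpha> \<omega> \<Omega>
            \<longrightarrow> betti_number 1 (top_of_set M) \<ge> 2) \<and>
         (simply_connected M \<longrightarrow>
            \<not> (\<exists>J g \<alpha> \<omega> \<Omega>. SU2_structure A J g \<alpha> \<omega> \<Omega> \<and> SUSY_IIB A kpar kperp \<alpha> \<omega> \<Omega>))"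
proof (intro conjI allI impI notI)
  fix J g \<alpha> \<omega> \<Omega>
  assume *: "SU2_structure A J g \<alpha> \<omega> \<Omega> \<and> SUSY_IIB A kpar kperp \<alpha> \<omega> \<Omega>"
  obtain d where d: "increment_cocycle M d"
    "\<forall>z. z \<noteq> 0 \<longrightarrow> (\<exists>\<gamma>. path \<gamma> \<and> path_image \<gamma> \<subseteq> M \<and> pathfinish \<gamma> = pathstart \<gamma> \<and>
       Re (cnj z * increment_cocycle.period d \<gamma>) \<noteq> 0)"
    by (rule SUSY_IIB_periods_span_plane[OF assms(4,5) conjunct1[OF *] conjunct2[OF *]])
  interpret increment_cocycle M d
    by (rule d(1))
  define S where "S = period ` {\<gamma>. path \<gamma> \<and> path_image \<gamma> \<subseteq> M \<and> pathfinish \<gamma> = pathstart \<gamma>}"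
  show "betti_number 1 (top_of_set M) \<ge> 2"
  proof (rule ccontr)
    assume betti: "\<not> 2 \<le> betti_number 1 (top_of_set M)"
    have "\<exists>z. z \<noteq> 0 \<and> (\<forall>x\<in>S. Re (cnj z * x) = 0)"
    proof (rule pairwise_dependent_complex_on_line)
      fix x y assume "x \<in> S" "y \<in> S"
      then show "\<exists>n m :: int. (n \<noteq> 0 \<or> m \<noteq> 0) \<and> real_of_int n *\<^sub>R x + real_of_int m *\<^sub>R y = 0"
        unfolding S_def using dependent_periods_of_betti_number_lt_2[OF betti] by auto
    qed
    then obtain z where z: "z \<noteq> 0" "\<forall>x\<in>S. Re (cnj z * x) = 0"
      by (elim exE conjE)
    obtain \<gamma> where \<gamma>: "path \<gamma>" "path_image \<gamma> \<subseteq> M" "pathfinish \<gamma> = pathstart \<gamma>" "Re (cnj z * period \<gamma>) \<noteq> 0"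
      using d(2)[rule_format, OF z(1)] by (elim exE conjE)
    have "period \<gamma> \<in> S"
      unfolding S_def using \<gamma>(1-3) by (intro imageI CollectI conjI)
    with z(2) \<gamma>(4) show False
      by simp
  qed
next
  assume sc: "simply_connected M"
  assume "\<exists>J g \<alpha> \<omega> \<Omega>. SU2_structure A J g \<alpha> \<omega> \<Omega> \<and> SUSY_IIB A kpar kperp \<alpha> \<omega> \<Omega>"
  then obtain J g \<alpha> \<omega> \<Omega> where *: "SU2_structure A J g \<alpha> \<omega> \<Omega>" "SUSY_IIB A kpar kperp \<alpha> \<omega> \<Omega>"
    by (elim exE conjE)
  obtain d where d: "increment_cocycle M d"
    "\<forall>z. z \<noteq> 0 \<longrightarrow> (\<exists>\<gamma>. path \<gamma> \<and> path_image \<gamma> \<subseteq> M \<and> pathfinish \<gamma> = pathstart \<gamma> \<and>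
       Re (cnj z * increment_cocycle.period d \<gamma>) \<noteq> 0)"
    by (rule SUSY_IIB_periods_span_plane[OF assms(4,5) *])
  interpret increment_cocycle M d
    by (rule d(1))
  obtain \<gamma> where \<gamma>: "path \<gamma>" "path_image \<gamma> \<subseteq> M" "pathfinish \<gamma> = pathstart \<gamma>" "Re (cnj 1 * period \<gamma>) \<noteq> 0"
    using d(2)[rule_format, OF one_neq_zero] by (elim exE conjE)
  from period_loop_simply_connected[OF sc \<gamma>(1-3)] \<gamma>(4) show False
    by simp
qed

end
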